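(* Let $\Gamma$ be a connected graph with $k\ge 2$ vertices (order $k$) and $m$ edges (size $m$). Let $A\subseteq\mathbb{R}^d$ be open with $\mathrm{Leb}(\partial A)=0$, and suppose $\lim_{n\to\infty} r_n=0$. Then: (i) If $p_n\equiv p$ is constant, then $$\lim_{n\to\infty} p^{-m}n^{-k}r_n^{-d(k-1)}E(G'_{n,A}(\Gamma))\ \ge\ \mu_{\Gamma,A}+(1-p)^{\binom{k}{2}}\mu'_{\Gamma,A}.$$ (ii) If $n^2p_n\to\alpha\in(0,\infty)$, then $$\lim_{n\to\infty} p_n^{-m}n^{-k}r_n^{-d(k-1)}E(G'_{n,A}(\Gamma))\ \ge\ \mu_{\Gamma,A}+e^{-\alpha/2}\mu'_{\Gamma,A}.$$ (iii) If $n^2p_n\to 0$, then $$\lim_{n\to\infty} p_n^{-m}n^{-k}r_n^{-d(k-1)}E(G'_{n,A}(\Gamma))\ \ge\ \mu_{\Gamma,A}+\mu'_{\Gamma,A}.$$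
   Context: Let $f:\mathbb{R}^d\to[0,\infty)$ be a bounded measurable probability density, and let $X_1,X_2,\dots$ be i.i.d. random points in $\mathbb{R}^d$ with density $f$. Put $\mathcal{X}_n=\{X_1,\dots,X_n\}$. Let $r_n>0$ and $p_n\in(0,1]$ be sequences. For a finite set $\mathcal{Y}\subset\mathbb{R}^d$ and $r>0$, $G(\mathcal{Y};r)$ is the graph with vertex set $\mathcal{Y}$ in which two distinct points are joined by an edge iff their Euclidean distance is at most $r$. The percolated random geometric graph $G(\mathcal{X}_n;p_n,r_n)$ is obtained from $G(\mathcal{X}_n;r_n)$ by keeping each edge with probability $p_n$ and deleting it otherwise, independently for all edges (and independently of the points). $G'_{n,A}(\Gamma)$ is the number of induced subgraphs of $G(\mathcal{X}_n;p_n,r_n)$ that are isomorphic to $\Gamma$ and whose vertex set has its left-most point (the point with smallest first coordinate) in $A$. For a finite set $\mathcal{Y}\subset\mathbb{R}^d$ with $k$ elements, $h_\Gamma(\mathcal{Y})=1$ if $G(\mathcal{Y};1)\cong\Gamma$ and $h_\Gamma(\mathcal{Y})=0$ otherwise; $g_\Gamma(\mathcal{Y})=1$ if $G(\mathcal{Y};1)$ strictly contains $\Gamma$ (i.e. has a subgraph isomorphic to $\Gamma$ but is not itself isomorphic to $\Gamma$), and $g_\Gamma(\mathcal{Y})=0$ otherwise. Both are $0$ if $\mathcal{Y}$ does not have exactly $k$ elements. Set $$\mu_{\Gamma,A}=\frac{1}{k!}\int_A f(x)^k\,dx\int_{(\mathbb{R}^d)^{k-1}}h_\Gamma(\{0,x_1,\dots,x_{k-1}\})\,d(x_1,\dots,x_{k-1}),$$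 $$\mu'_{\Gamma,A}=\frac{1}{k!}\int_A f(x)^k\,dx\int_{(\mathbb{R}^d)^{k-1}}g_\Gamma(\{0,x_1,\dots,x_{k-1}\})\,d(x_1,\dots,x_{k-1}).$$ *)

theory Defs
  imports "HOL-Probability.Probability"
begin

text \<open>A simple graph is a pair of a vertex set and a set of two-element subsets of it.\<close>

type_synonym 'a sgraph = "'a set \<times> 'a set set"

abbreviation verts :: "'a sgraph \<Rightarrow> 'a set" where "verts \<equiv> fst"
abbreviation edges :: "'a sgraph \<Rightarrow> 'a set set" where "edges \<equiv> snd"

definition simple_graph :: "'a sgraph \<Rightarrow> bool" where
  "simple_graph G \<longleftrightarrow> finite (verts G) \<and> (\<forall>e\<in>edges G. e \<subseteq> verts G \<and> card e = 2)"

definition connected_graph :: "'a sgraph \<Rightarrow> bool" where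
  "connected_graph G \<longleftrightarrow> verts G \<noteq> {} \<and>
     (\<forall>u\<in>verts G. \<forall>v\<in>verts G. (u, v) \<in> {(x, y). {x, y} \<in> edges G}\<^sup>*)"

definition graph_iso :: "'a sgraph \<Rightarrow> 'b sgraph \<Rightarrow> bool" where
  "graph_iso G H \<longleftrightarrow> (\<exists>\<phi>. bij_betw \<phi> (verts G) (verts H) \<and>
     (\<forall>u\<in>verts G. \<forall>v\<in>verts G. {u, v} \<in> edges G \<longleftrightarrow> {\<phi> u, \<phi> v} \<in> edges H))"

definition subgraph :: "'a sgraph \<Rightarrow> 'a sgraph \<Rightarrow> bool" where
  "subgraph H G \<longleftrightarrow> simple_graph H \<and> verts H \<subseteq> verts G \<and> edges H \<subseteq> edges G"

definition induced :: "'a sgraph \<Rightarrow> 'a set \<Rightarrow> 'a sgraph" where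
  "induced G S = (S, {e \<in> edges G. e \<subseteq> S})"

definition strictly_contains :: "'a sgraph \<Rightarrow> 'b sgraph \<Rightarrow> bool" where
  "strictly_contains G \<Gamma> \<longleftrightarrow> (\<exists>H. subgraph H G \<and> graph_iso H \<Gamma>) \<and> \<not> graph_iso G \<Gamma>"

definition geom_graph :: "(real ^ 'd) set \<Rightarrow> real \<Rightarrow> (real ^ 'd) sgraph" where
  "geom_graph Y r = (Y, {{x, y} | x y. x \<in> Y \<and> y \<in> Y \<and> x \<noteq> y \<and> dist x y \<le> r})"

definition h_fun :: "'v sgraph \<Rightarrow> (real ^ 'd) set \<Rightarrow> real" where
  "h_fun \<Gamma> Y = (if card Y = card (verts \<Gamma>) \<and> graph_iso (geom_graph Y 1) \<Gamma> then 1 else 0)"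

definition g_fun :: "'v sgraph \<Rightarrow> (real ^ 'd) set \<Rightarrow> real" where
  "g_fun \<Gamma> Y = (if card Y = card (verts \<Gamma>) \<and> strictly_contains (geom_graph Y 1) \<Gamma> then 1 else 0)"

text \<open>In the next two definitions the points \<open>x\<^sub>1, \<dots>, x\<^sub>k\<^sub>-\<^sub>1\<close> are the values at \<open>1, \<dots>, k - 1\<close> of an
  element of the product space, so that the inner integral is the one over \<open>(k - 1)\<close>-tuples.\<close>

definition mu :: "'v sgraph \<Rightarrow> (real ^ 'd \<Rightarrow> real) \<Rightarrow> (real ^ 'd) set \<Rightarrow> real" where
  "mu \<Gamma> f A = (let k = card (verts \<Gamma>) in
     1 / fact k * (LINT x:A|lborel. f x ^ k) *
     (LINT x|(\<Pi>\<^sub>M i\<in>{1..k-1}. lborel :: (real ^ 'd) measure). h_fun \<Gamma> (insert 0 (x ` {1..k-1}))))"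

definition mu' :: "'v sgraph \<Rightarrow> (real ^ 'd \<Rightarrow> real) \<Rightarrow> (real ^ 'd) set \<Rightarrow> real" where
  "mu' \<Gamma> f A = (let k = card (verts \<Gamma>) in
     1 / fact k * (LINT x:A|lborel. f x ^ k) *
     (LINT x|(\<Pi>\<^sub>M i\<in>{1..k-1}. lborel :: (real ^ 'd) measure). g_fun \<Gamma> (insert 0 (x ` {1..k-1}))))"

text \<open>The points are \<open>X 1, X 2, \<dots>\<close>, and \<open>keep n {i, j}\<close> is the event that the edge between
  \<open>X i\<close> and \<open>X j\<close>, if present in the geometric graph on the first \<open>n\<close> points, is retained.
  The points and the retention marks have different types; their joint mutual independence is
  therefore stated for the \<open>\<sigma>\<close>-algebras they generate. Marks for different values of \<open>n\<close> may
  depend on each other in any way.\<close>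

locale percolated_points = prob_space M for M :: "'w measure" +
  fixes f :: "real ^ 'd \<Rightarrow> real"
    and X :: "nat \<Rightarrow> 'w \<Rightarrow> real ^ 'd"
    and p :: "nat \<Rightarrow> real"
    and keep :: "nat \<Rightarrow> nat set \<Rightarrow> 'w \<Rightarrow> bool"
  assumes density_nonneg: "\<And>x. 0 \<le> f x"
    and density_bounded: "bounded (range f)"
    and density_measurable: "f \<in> borel_measurable borel"
    and points_distributed: "\<And>i. i \<ge> 1 \<Longrightarrow> distributed M lborel (X i) (\<lambda>x. ennreal (f x))"
    and prob_range: "\<And>n. n \<ge> 1 \<Longrightarrow> 0 < p n \<and> p n \<le> 1"
    and marks_measurable: "\<And>n e. n \<ge> 1 \<Longrightarrow> e \<subseteq> {1..n} \<Longrightarrow> card e = 2 \<Longrightarrow>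
          keep n e \<in> measurable M (count_space UNIV)"
    and marks_prob: "\<And>n e. n \<ge> 1 \<Longrightarrow> e \<subseteq> {1..n} \<Longrightarrow> card e = 2 \<Longrightarrow>
          prob {\<omega> \<in> space M. keep n e \<omega>} = p n"
    and indep: "\<And>n. n \<ge> 1 \<Longrightarrow>
          indep_sets
            (\<lambda>s. case s of
                Inl i \<Rightarrow> sets (vimage_algebra (space M) (X i) borel)
              | Inr e \<Rightarrow> sets (vimage_algebra (space M) (keep n e) (count_space UNIV)))
            (Inl ` {1..} \<union> Inr ` {e. e \<subseteq> {1..n} \<and> card e = 2})"

definition perc_graph ::
  "(nat \<Rightarrow> 'w \<Rightarrow> real ^ 'd) \<Rightarrow> (nat \<Rightarrow> nat set \<Rightarrow> 'w \<Rightarrow> bool) \<Rightarrow> (nat \<Rightarrow> real) \<Rightarrow> nat \<Rightarrow> 'w \<Rightarrow>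
     (real ^ 'd) sgraph" where
  "perc_graph X keep r n \<omega> =
     ((\<lambda>i. X i \<omega>) ` {1..n},
      {{X i \<omega>, X j \<omega>} | i j. i \<in> {1..n} \<and> j \<in> {1..n} \<and>
         {X i \<omega>, X j \<omega>} \<in> edges (geom_graph ((\<lambda>i. X i \<omega>) ` {1..n}) (r n)) \<and> keep n {i, j} \<omega>})"

definition first_coord :: "real ^ 'd :: {finite, linorder} \<Rightarrow> real" where
  "first_coord x = x $ Min UNIV"

text \<open>Ties for the smallest first coordinate have probability zero. Asking for some left-most point
  in \<open>A\<close>, rather than choosing one, keeps the count below measurable.\<close>

definition leftmost_in ::
  "(real ^ 'd :: {finite, linorder}) set \<Rightarrow> (real ^ 'd :: {finite, linorder}) set \<Rightarrow> bool" where
  "leftmost_in A S \<longleftrightarrow> (\<exists>x\<in>S. x \<in> A \<and> (\<forall>y\<in>S. first_coord x \<le> first_coord y))"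

definition induced_count ::
  "'v sgraph \<Rightarrow> (real ^ 'd :: {finite, linorder}) set \<Rightarrow>
     (real ^ 'd :: {finite, linorder}) sgraph \<Rightarrow> nat" where
  "induced_count \<Gamma> A G = card {S. S \<subseteq> verts G \<and> graph_iso (induced G S) \<Gamma> \<and> leftmost_in A S}"

end

theory Submission
  imports Defs "HOL-Real_Asymp.Real_Asymp"
begin

text \<open>
  Almost surely the points are distinct, and then the count is a sum over the \<open>k\<close>-element index sets
  \<open>J\<close>. Condition on the geometric graph \<open>G\<close> spanned by the \<open>k\<close> points of \<open>J\<close>. Percolation leaves
  precisely the edges of a given \<open>H \<subseteq> G\<close> with probability \<open>p\<^sup>m (1 - p)\<^bsup>|G| - m\<^esup>\<close> when \<open>H\<close> has \<open>m\<close> edges.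
  So if \<open>c(G)\<close> denotes the number of copies of \<open>\<Gamma>\<close> among the spanning subgraphs of \<open>G\<close>, and \<open>I\<^sub>r(G)\<close>
  the probability that \<open>k\<close> independent points with density \<open>f\<close> have geometric graph \<open>G\<close> at radius
  \<open>r\<close> and their left-most point in \<open>A\<close>, then the expectation is
  \<open>(n choose k) p\<^sup>m \<Sum>\<^sub>G c(G) (1 - p)\<^bsup>|G| - m\<^esup> I\<^sub>r(G)\<close> (\<open>expectation_induced_count\<close>).

  The substitution \<open>x\<^sub>i = x\<^sub>0 + r y\<^sub>i\<close> turns \<open>I\<^sub>r(G)\<close> into \<open>r\<^bsup>d(k-1)\<^esup>\<close> times an integral over \<open>y\<close> and \<open>x\<^sub>0\<close>
  in which the radius enters only through translates of \<open>f\<close> by \<open>r y\<^sub>i\<close> and through the position of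
  the left-most point. Translates of an integrable function converge in the mean
  (\<open>translation_defect_tendsto\<close>), and off the boundary of \<open>A\<close> all \<open>k\<close> points lie on the same side as
  \<open>x\<^sub>0\<close> once \<open>r\<close> is small. Moreover \<open>c(G) \<noteq> 0\<close> forces \<open>G\<close> to be connected, which confines \<open>y\<close> to a
  bounded set, so dominated convergence applies: \<open>I\<^sub>r(G) / r\<^bsup>d(k-1)\<^esup>\<close> tends to the integral of \<open>f\<^sup>k\<close> over
  \<open>A\<close> times the volume of the configurations \<open>y\<close> for which \<open>0, y\<^sub>1, \<dots>, y\<^sub>k\<^sub>-\<^sub>1\<close> span \<open>G\<close> at radius \<open>1\<close>
  (\<open>config_integral_tendsto\<close>).

  Hence the normalised expectation converges as soon as \<open>p\<^sub>n\<close> does, say to \<open>q\<close>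
  (\<open>normalised_expectation_tendsto\<close>). In the limit a graph \<open>G\<close> isomorphic to \<open>\<Gamma>\<close> has weight \<open>1\<close>; these
  graphs make up \<open>\<mu>\<close>. A graph that strictly contains \<open>\<Gamma>\<close> has weight at least \<open>(1 - q)\<^bsup>|G| - m\<^esup>\<close>, which is at
  least \<open>(1 - q)\<close> to the power \<open>k choose 2\<close>; these graphs make up \<open>\<mu>'\<close> (\<open>count_limit_ge\<close>). If \<open>n\<^sup>2 p\<^sub>n\<close>
  converges, then \<open>q = 0\<close>, all powers of \<open>1 - q\<close> are \<open>1\<close>, and the lower bounds hold
  with any factor in \<open>[0, 1]\<close> in front of \<open>\<mu>'\<close>, in particular with \<open>e\<^bsup>-\<alpha>/2\<^esup>\<close> and with \<open>1\<close>.
\<close>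

section \<open>Continuity of translations in the mean\<close>

lemma lborel_eq_distr_translate:
  fixes t :: "'a::euclidean_space"
  shows "lborel = distr lborel borel (\<lambda>x. x + t)"
  using lborel_affine[of 1 t] by (simp add: density_1 add.commute)

lemma lborel_integral_translate:
  fixes t :: "'a::euclidean_space" and u :: "'a \<Rightarrow> real"
  assumes "u \<in> borel_measurable borel"
  shows "(\<integral>x. u (x + t) \<partial>lborel) = (\<integral>x. u x \<partial>lborel)"
  by (subst (2) lborel_eq_distr_translate[of t]) (use assms in \<open>simp add: integral_distr\<close>)

lemma lborel_integrable_translate:
  fixes t :: "'a::euclidean_space" and u :: "'a \<Rightarrow> real"
  assumes "integrable lborel u"
  shows "integrable lborel (\<lambda>x. u (x + t))"
proof -
  have "integrable (distr lborel borel (\<lambda>x. x + t)) u"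
    using assms lborel_eq_distr_translate[of t] by metis
  then show ?thesis
    by (rule integrable_distr[rotated]) simp
qed

text \<open>Replacing \<open>u\<close> by \<open>v\<close> costs twice their distance in the mean, because that distance does not
  change under translation.\<close>

lemma translation_defect_perturb:
  fixes u v :: "'a::euclidean_space \<Rightarrow> real"
  assumes u: "integrable lborel u" and v: "integrable lborel v"
  shows "(\<integral>x. \<bar>u (x + t) - u x\<bar> \<partial>lborel)
    \<le> 2 * (\<integral>x. \<bar>u x - v x\<bar> \<partial>lborel) + (\<integral>x. \<bar>v (x + t) - v x\<bar> \<partial>lborel)"
proof -
  note ut = lborel_integrable_translate[OF u, of t] and vt = lborel_integrable_translate[OF v, of t]
  have [measurable]: "u \<in> borel_measurable borel" "v \<in> borel_measurable borel"
    using u v by (auto dest: borel_measurable_integrable)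
  have "(\<integral>x. \<bar>u (x + t) - u x\<bar> \<partial>lborel)
      \<le> (\<integral>x. \<bar>u (x + t) - v (x + t)\<bar> + \<bar>v (x + t) - v x\<bar> + \<bar>u x - v x\<bar> \<partial>lborel)"
    by (rule integral_mono) (use u v ut vt in auto)
  also have "\<dots> = (\<integral>x. \<bar>u (x + t) - v (x + t)\<bar> \<partial>lborel) + (\<integral>x. \<bar>v (x + t) - v x\<bar> \<partial>lborel)
      + (\<integral>x. \<bar>u x - v x\<bar> \<partial>lborel)"
    using u v ut vt by (simp add: Bochner_Integration.integral_add)
  also have "(\<integral>x. \<bar>u (x + t) - v (x + t)\<bar> \<partial>lborel) = (\<integral>x. \<bar>u x - v x\<bar> \<partial>lborel)"
    by (rule lborel_integral_translate[of "\<lambda>x. \<bar>u x - v x\<bar>"]) simp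
  finally show ?thesis by simp
qed

lemma translation_defect_tendsto_by_approximation:
  fixes u :: "'a::euclidean_space \<Rightarrow> real"
  assumes u: "integrable lborel u"
    and approx: "\<And>e. e > 0 \<Longrightarrow> \<exists>v. integrable lborel v \<and> (\<integral>x. \<bar>u x - v x\<bar> \<partial>lborel) \<le> e \<and>
      (\<lambda>n. \<integral>x. \<bar>v (x + t n) - v x\<bar> \<partial>lborel) \<longlonglongrightarrow> 0"
  shows "(\<lambda>n. \<integral>x. \<bar>u (x + t n) - u x\<bar> \<partial>lborel) \<longlonglongrightarrow> 0"
proof (rule LIMSEQ_I)
  fix e :: real assume "e > 0"
  then obtain v where v: "integrable lborel v" "(\<integral>x. \<bar>u x - v x\<bar> \<partial>lborel) \<le> e / 4"
      "(\<lambda>n. \<integral>x. \<bar>v (x + t n) - v x\<bar> \<partial>lborel) \<longlonglongrightarrow> 0"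
    using approx[of "e / 4"] by auto
  obtain N where N: "\<And>n. n \<ge> N \<Longrightarrow> norm ((\<integral>x. \<bar>v (x + t n) - v x\<bar> \<partial>lborel) - 0) < e / 4"
    using LIMSEQ_D[OF v(3), of "e / 4"] \<open>e > 0\<close> by auto
  have "norm ((\<integral>x. \<bar>u (x + t n) - u x\<bar> \<partial>lborel) - 0) < e" if "n \<ge> N" for n
  proof -
    have "0 \<le> (\<integral>x. \<bar>u (x + t n) - u x\<bar> \<partial>lborel)" by simp
    then show ?thesis
      using translation_defect_perturb[OF u v(1), of "t n"] v(2) N[OF that] \<open>e > 0\<close> by auto
  qed
  then show "\<exists>N. \<forall>n\<ge>N. norm ((\<integral>x. \<bar>u (x + t n) - u x\<bar> \<partial>lborel) - 0) < e" by blast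
qed

text \<open>The measure of the overlap \<open>U \<inter> (U - t\<^sub>n)\<close> tends to that of \<open>U\<close>, since every point of an open set
  stays in it under small translations; the defect is twice the measure of what is missing.\<close>

lemma translation_defect_tendsto_open:
  fixes U :: "'a::euclidean_space set"
  assumes "open U" and fin: "emeasure lborel U < \<infinity>" and t: "t \<longlonglongrightarrow> 0"
  shows "(\<lambda>n. \<integral>x. \<bar>indicator U (x + t n) - (indicator U x :: real)\<bar> \<partial>lborel) \<longlonglongrightarrow> 0"
proof -
  have [measurable]: "U \<in> sets borel" using \<open>open U\<close> by simp
  have iU: "integrable lborel (indicator U :: 'a \<Rightarrow> real)" using fin by simp
  have iUt: "integrable lborel (\<lambda>x. indicator U (x + t n) :: real)" for n
    by (rule lborel_integrable_translate[OF iU])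
  have iP: "integrable lborel (\<lambda>x. indicator U (x + t n) * indicator U x :: real)" for n
    by (rule Bochner_Integration.integrable_bound[OF iU]) (auto simp: indicator_def)
  have eq: "(\<integral>x. \<bar>indicator U (x + t n) - (indicator U x :: real)\<bar> \<partial>lborel) =
      2 * (\<integral>x. indicator U x \<partial>lborel) - 2 * (\<integral>x. indicator U (x + t n) * indicator U x \<partial>lborel)" for n
  proof -
    have "(\<integral>x. \<bar>indicator U (x + t n) - (indicator U x :: real)\<bar> \<partial>lborel) =
        (\<integral>x. indicator U (x + t n) + indicator U x - 2 * (indicator U (x + t n) * indicator U x) \<partial>lborel)"
      by (rule Bochner_Integration.integral_cong) (auto simp: indicator_def)
    also have "\<dots> = (\<integral>x. indicator U (x + t n) \<partial>lborel) + (\<integral>x. indicator U x \<partial>lborel)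
        - 2 * (\<integral>x. indicator U (x + t n) * indicator U x \<partial>lborel)"
      using iU iUt iP
      by (subst Bochner_Integration.integral_diff) (auto simp del: Bochner_Integration.integral_indicator)
    also have "(\<integral>x. indicator U (x + t n) \<partial>lborel) = (\<integral>x. (indicator U x :: real) \<partial>lborel)"
      by (rule lborel_integral_translate) simp
    finally show ?thesis by simp
  qed
  have "(\<lambda>n. \<integral>x. indicator U (x + t n) * indicator U x \<partial>lborel) \<longlonglongrightarrow> (\<integral>x. (indicator U x :: real) \<partial>lborel)"
  proof (rule integral_dominated_convergence[where w = "indicator U"])
    show "AE x in lborel. (\<lambda>n. indicator U (x + t n) * indicator U x) \<longlonglongrightarrow> (indicator U x :: real)"
    proof (rule AE_I2)
      fix x :: 'a
      show "(\<lambda>n. indicator U (x + t n) * indicator U x) \<longlonglongrightarrow> (indicator U x :: real)"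
      proof (cases "x \<in> U")
        case True
        have "(\<lambda>n. x + t n) \<longlonglongrightarrow> x" using tendsto_add[OF tendsto_const t, of x] by simp
        then have "eventually (\<lambda>n. x + t n \<in> U) sequentially"
          using \<open>open U\<close> True by (rule topological_tendstoD)
        then show ?thesis
          by (intro tendsto_eventually) (auto elim!: eventually_mono simp: True)
      qed simp
    qed
  qed (use iU in \<open>auto simp: indicator_def\<close>)
  then have "(\<lambda>n. 2 * (\<integral>x. indicator U x \<partial>lborel) -
      2 * (\<integral>x. indicator U (x + t n) * indicator U x \<partial>lborel)) \<longlonglongrightarrow>
      2 * (\<integral>x. indicator U x \<partial>lborel) - 2 * (\<integral>x. (indicator U x :: real) \<partial>lborel)"
    by (intro tendsto_intros)
  then show ?thesis unfolding eq by simp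
qed

text \<open>Open sets approximate Borel sets by outer regularity, and simple functions approximate integrable
  ones, so the case of open sets carries over to all integrable functions.\<close>

lemma translation_defect_tendsto:
  fixes u :: "'a::euclidean_space \<Rightarrow> real"
  assumes "integrable lborel u" and t: "t \<longlonglongrightarrow> 0"
  shows "(\<lambda>n. \<integral>x. \<bar>u (x + t n) - u x\<bar> \<partial>lborel) \<longlonglongrightarrow> 0"
  using assms(1)
proof (induction u rule: integrable_induct)
  case (base A c)
  have [measurable]: "A \<in> sets borel" using base by simp
  have "(\<lambda>n. \<integral>x. \<bar>indicator A (x + t n) - (indicator A x :: real)\<bar> \<partial>lborel) \<longlonglongrightarrow> 0"
  proof (rule translation_defect_tendsto_by_approximation)
    show "integrable lborel (indicator A :: 'a \<Rightarrow> real)" using base by simp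
    fix e :: real assume "e > 0"
    then obtain U where U: "open U" "A \<subseteq> U" "emeasure lborel (U - A) < ennreal e"
      using outer_regular_lborel[of A e] by auto
    have [measurable]: "U \<in> sets borel" using U by simp
    have "emeasure lborel U = emeasure lborel A + emeasure lborel (U - A)"
      using U by (subst plus_emeasure) (auto simp: Un_absorb1)
    also have "\<dots> < \<infinity>" using U(3) base(2) by (simp add: less_top order.strict_trans)
    finally have finU: "emeasure lborel U < \<infinity>" .
    have "(\<integral>x. \<bar>indicator A x - indicator U x\<bar> \<partial>lborel) = (\<integral>x. (indicator (U - A) x :: real) \<partial>lborel)"
      by (rule Bochner_Integration.integral_cong) (use U in \<open>auto simp: indicator_def\<close>)
    also have "\<dots> \<le> e"
      using U(3) \<open>e > 0\<close> by (simp add: measure_def enn2real_leI)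
    finally show "\<exists>v. integrable lborel v \<and> (\<integral>x. \<bar>indicator A x - v x\<bar> \<partial>lborel) \<le> e \<and>
        (\<lambda>n. \<integral>x. \<bar>v (x + t n) - v x\<bar> \<partial>lborel) \<longlonglongrightarrow> 0"
      using translation_defect_tendsto_open[OF U(1) finU t] finU
      by (intro exI[of _ "indicator U"]) auto
  qed
  from tendsto_mult_right_zero[OF this, of "\<bar>c\<bar>"]
  show ?case
    by (simp add: abs_mult[symmetric] algebra_simps flip: Bochner_Integration.integral_mult_right_zero)
next
  case (add u v)
  have ut: "integrable lborel (\<lambda>x. u (x + t n))" "integrable lborel (\<lambda>x. v (x + t n))" for n
    using add by (auto intro: lborel_integrable_translate)
  show ?case
  proof (rule tendsto_sandwich[OF _ _ tendsto_const tendsto_add_zero[OF add(3,4)]])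
    show "\<forall>\<^sub>F n in sequentially. (\<integral>x. \<bar>u (x + t n) + v (x + t n) - (u x + v x)\<bar> \<partial>lborel)
        \<le> (\<integral>x. \<bar>u (x + t n) - u x\<bar> \<partial>lborel) + (\<integral>x. \<bar>v (x + t n) - v x\<bar> \<partial>lborel)"
    proof (rule always_eventually, rule allI)
      fix n
      have "(\<integral>x. \<bar>u (x + t n) + v (x + t n) - (u x + v x)\<bar> \<partial>lborel)
          \<le> (\<integral>x. \<bar>u (x + t n) - u x\<bar> + \<bar>v (x + t n) - v x\<bar> \<partial>lborel)"
        using add ut by (intro integral_mono) auto
      also have "\<dots> = (\<integral>x. \<bar>u (x + t n) - u x\<bar> \<partial>lborel) + (\<integral>x. \<bar>v (x + t n) - v x\<bar> \<partial>lborel)"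
        using add ut by (intro Bochner_Integration.integral_add) auto
      finally show "(\<integral>x. \<bar>u (x + t n) + v (x + t n) - (u x + v x)\<bar> \<partial>lborel)
          \<le> (\<integral>x. \<bar>u (x + t n) - u x\<bar> \<partial>lborel) + (\<integral>x. \<bar>v (x + t n) - v x\<bar> \<partial>lborel)" .
    qed
  qed auto
next
  case (lim u s)
  show ?case
  proof (rule translation_defect_tendsto_by_approximation[OF \<open>integrable lborel u\<close>])
    fix e :: real assume "e > 0"
    have meas: "s i \<in> borel_measurable borel" "u \<in> borel_measurable borel" for i
      using lim by (auto dest: borel_measurable_integrable)
    \<comment> \<open>The constant \<open>3\<close> comes from \<open>\<bar>s i x\<bar> \<le> 2 * \<bar>u x\<bar>\<close>.\<close>
    have "(\<lambda>i. \<integral>x. \<bar>u x - s i x\<bar> \<partial>lborel) \<longlonglongrightarrow> (\<integral>x. 0 \<partial>(lborel :: 'a measure))"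
    proof (rule integral_dominated_convergence[where w = "\<lambda>x. 3 * \<bar>u x\<bar>"])
      show "AE x in lborel. (\<lambda>i. \<bar>u x - s i x\<bar>) \<longlonglongrightarrow> 0"
      proof (rule AE_I2)
        fix x :: 'a
        have "(\<lambda>i. \<bar>u x - s i x\<bar>) \<longlonglongrightarrow> \<bar>u x - u x\<bar>"
          by (intro tendsto_intros lim(2)) simp
        then show "(\<lambda>i. \<bar>u x - s i x\<bar>) \<longlonglongrightarrow> 0" by simp
      qed
      show "AE x in lborel. norm \<bar>u x - s i x\<bar> \<le> 3 * \<bar>u x\<bar>" for i
      proof (rule AE_I2)
        fix x show "norm \<bar>u x - s i x\<bar> \<le> 3 * \<bar>u x\<bar>" using lim(3)[of x i] by simp
      qed
    qed (use lim meas in auto)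
    from LIMSEQ_D[OF this \<open>e > 0\<close>]
    obtain i where "(\<integral>x. \<bar>u x - s i x\<bar> \<partial>lborel) \<le> e" by (force intro: less_imp_le)
    then show "\<exists>v. integrable lborel v \<and> (\<integral>x. \<bar>u x - v x\<bar> \<partial>lborel) \<le> e \<and>
        (\<lambda>n. \<integral>x. \<bar>v (x + t n) - v x\<bar> \<partial>lborel) \<longlonglongrightarrow> 0"
      using lim(1,5) by blast
  qed
qed

section \<open>Products of translated densities\<close>

text \<open>One translated factor is replaced by its limit at a time. As all factors are bounded, the error
  of each replacement is controlled by a single translation defect. The integrability claims are part of
  the statement because the induction needs them.\<close>

lemma prod_translates_tendsto:
  fixes f :: "'a::euclidean_space \<Rightarrow> real"
  assumes f: "integrable lborel f" and nonneg: "\<And>x. 0 \<le> f x" and bound: "\<And>x. f x \<le> B"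
    and r: "r \<longlonglongrightarrow> 0" and "finite I"
  shows "(\<lambda>n. \<integral>a. \<bar>f a * (\<Prod>i\<in>I. f (a + r n *\<^sub>R y i)) - f a ^ Suc (card I)\<bar> \<partial>lborel) \<longlonglongrightarrow> 0
    \<and> (\<forall>n. integrable lborel (\<lambda>a. f a * (\<Prod>i\<in>I. f (a + r n *\<^sub>R y i))))
    \<and> integrable lborel (\<lambda>a. f a ^ Suc (card I))"
  using \<open>finite I\<close>
proof (induction I rule: finite_induct)
  case empty
  then show ?case using f by simp
next
  case (insert j I)
  define P where "P n a = f a * (\<Prod>i\<in>I. f (a + r n *\<^sub>R y i))" for n a
  define Q where "Q a = f a ^ Suc (card I)" for a
  define g where "g n a = f (a + r n *\<^sub>R y j)" for n a
  have B: "0 \<le> B" using nonneg bound by (rule order_trans)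
  have [measurable]: "f \<in> borel_measurable borel" using f by (auto dest: borel_measurable_integrable)
  have [measurable]: "g n \<in> borel_measurable borel" for n unfolding g_def by measurable
  have IH: "(\<lambda>n. \<integral>a. \<bar>P n a - Q a\<bar> \<partial>lborel) \<longlonglongrightarrow> 0"
    and P: "integrable lborel (P n)" and Q: "integrable lborel Q" for n
    using insert.IH unfolding P_def Q_def by auto
  have gi: "integrable lborel (g n)" for n
    unfolding g_def by (rule lborel_integrable_translate[OF f])
  have g: "0 \<le> g n a" "g n a \<le> B" for n a unfolding g_def by (auto simp: nonneg bound)
  define C where "C = B ^ Suc (card I)"
  have Q_bd: "0 \<le> Q a" "Q a \<le> C" for a
    unfolding Q_def C_def by (intro zero_le_power nonneg power_mono bound)+
  have PB: "integrable lborel (\<lambda>a. P n a * B)" and QB: "integrable lborel (\<lambda>a. Q a * B)" for n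
    using P Q by auto
  have Pg: "integrable lborel (\<lambda>a. P n a * g n a)" for n
    by (rule Bochner_Integration.integrable_bound[OF PB[of n]])
      (use g P[of n] B in \<open>auto simp: abs_mult intro!: mult_left_mono dest: borel_measurable_integrable\<close>)
  have Qf: "integrable lborel (\<lambda>a. Q a * f a)"
    by (rule Bochner_Integration.integrable_bound[OF QB])
      (use nonneg bound Q B in \<open>auto simp: abs_mult intro!: mult_left_mono dest: borel_measurable_integrable\<close>)
  have "(\<lambda>n. r n *\<^sub>R y j) \<longlonglongrightarrow> 0" using r by (intro tendsto_eq_intros) auto
  from translation_defect_tendsto[OF f this]
  have "(\<lambda>n. \<integral>a. \<bar>g n a - f a\<bar> \<partial>lborel) \<longlonglongrightarrow> 0" unfolding g_def .
  then have lim0: "(\<lambda>n. B * (\<integral>a. \<bar>P n a - Q a\<bar> \<partial>lborel) + C * (\<integral>a. \<bar>g n a - f a\<bar> \<partial>lborel)) \<longlonglongrightarrow> 0"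
    by (intro tendsto_add_zero tendsto_mult_right_zero IH)
  have bd: "(\<integral>a. \<bar>P n a * g n a - Q a * f a\<bar> \<partial>lborel) \<le>
      B * (\<integral>a. \<bar>P n a - Q a\<bar> \<partial>lborel) + C * (\<integral>a. \<bar>g n a - f a\<bar> \<partial>lborel)" for n
  proof -
    have "(\<integral>a. \<bar>P n a * g n a - Q a * f a\<bar> \<partial>lborel) \<le>
        (\<integral>a. B * \<bar>P n a - Q a\<bar> + C * \<bar>g n a - f a\<bar> \<partial>lborel)"
    proof (rule integral_mono)
      fix a
      have "P n a * g n a - Q a * f a = (P n a - Q a) * g n a + Q a * (g n a - f a)"
        by (simp add: algebra_simps)
      then have "\<bar>P n a * g n a - Q a * f a\<bar> \<le> \<bar>P n a - Q a\<bar> * g n a + Q a * \<bar>g n a - f a\<bar>"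
        using g(1)[of n a] Q_bd(1)[of a] abs_triangle_ineq[of "(P n a - Q a) * g n a" "Q a * (g n a - f a)"]
        by (simp add: abs_mult)
      also have "\<dots> \<le> \<bar>P n a - Q a\<bar> * B + C * \<bar>g n a - f a\<bar>"
        by (intro add_mono mult_mono) (auto simp: g Q_bd B order_trans[OF Q_bd])
      finally show "\<bar>P n a * g n a - Q a * f a\<bar> \<le> B * \<bar>P n a - Q a\<bar> + C * \<bar>g n a - f a\<bar>"
        by (simp add: mult.commute)
    qed (use Pg Qf P Q gi f in auto)
    also have "\<dots> = B * (\<integral>a. \<bar>P n a - Q a\<bar> \<partial>lborel) + C * (\<integral>a. \<bar>g n a - f a\<bar> \<partial>lborel)"
      using P Q gi f by (subst Bochner_Integration.integral_add) auto
    finally show ?thesis .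
  qed
  have "(\<lambda>n. \<integral>a. \<bar>P n a * g n a - Q a * f a\<bar> \<partial>lborel) \<longlonglongrightarrow> 0"
    by (rule tendsto_sandwich[OF _ _ tendsto_const lim0]) (use bd in auto)
  moreover have "f a * (\<Prod>i\<in>insert j I. f (a + r n *\<^sub>R y i)) = P n a * g n a" for n a
    using insert.hyps by (simp add: P_def g_def mult_ac)
  moreover have "f a ^ Suc (card (insert j I)) = Q a * f a" for a
    using insert.hyps by (simp add: Q_def mult_ac)
  ultimately show ?case using Pg Qf by (simp del: power_Suc)
qed

text \<open>The cut-off \<open>c n\<close> is the indicator that the left-most point of the shrinking configuration is in
  \<open>A\<close>; it converges only pointwise, so it is treated by dominated convergence after the product of
  densities has been replaced by its limit.\<close>

lemma prod_translates_indicator_tendsto: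
  fixes f :: "'a::euclidean_space \<Rightarrow> real"
  assumes f: "integrable lborel f" and nonneg: "\<And>x. 0 \<le> f x" and bound: "\<And>x. f x \<le> B"
    and r: "r \<longlonglongrightarrow> 0" and I: "finite I"
    and c_meas: "\<And>n. c n \<in> borel_measurable borel" "c' \<in> borel_measurable borel"
    and c_bd: "\<And>n a. 0 \<le> c n a \<and> c n a \<le> 1" "\<And>a. 0 \<le> c' a \<and> c' a \<le> 1"
    and c_lim: "AE a in lborel. (\<lambda>n. c n a) \<longlonglongrightarrow> (c' a :: real)"
  shows "(\<lambda>n. \<integral>a. f a * (\<Prod>i\<in>I. f (a + r n *\<^sub>R y i)) * c n a \<partial>lborel)
      \<longlonglongrightarrow> (\<integral>a. f a ^ Suc (card I) * c' a \<partial>lborel)"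
proof -
  define P where "P n a = f a * (\<Prod>i\<in>I. f (a + r n *\<^sub>R y i))" for n a
  define Q where "Q a = f a ^ Suc (card I)" for a
  have lim: "(\<lambda>n. \<integral>a. \<bar>P n a - Q a\<bar> \<partial>lborel) \<longlonglongrightarrow> 0"
    and P: "integrable lborel (P n)" and Q: "integrable lborel Q" for n
    using prod_translates_tendsto[OF f nonneg bound r I] unfolding P_def Q_def by auto
  note [measurable] = c_meas borel_measurable_integrable[OF P] borel_measurable_integrable[OF Q]
  have Pc: "integrable lborel (\<lambda>a. P n a * c n a)" for n
    by (rule Bochner_Integration.integrable_bound[OF P[of n]])
      (use c_bd in \<open>auto simp: abs_mult intro!: mult_left_le\<close>)
  have Qc: "integrable lborel (\<lambda>a. Q a * c n a)" for n
    by (rule Bochner_Integration.integrable_bound[OF Q])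
      (use c_bd in \<open>auto simp: abs_mult intro!: mult_left_le\<close>)
  have 1: "(\<lambda>n. \<integral>a. Q a * c n a \<partial>lborel) \<longlonglongrightarrow> (\<integral>a. Q a * c' a \<partial>lborel)"
    by (rule integral_dominated_convergence[where w = "\<lambda>a. \<bar>Q a\<bar>"])
      (use c_bd c_lim Q in \<open>auto simp: abs_mult intro!: mult_left_le elim!: eventually_mono intro: tendsto_mult_left\<close>)
  have "\<bar>(\<integral>a. P n a * c n a \<partial>lborel) - (\<integral>a. Q a * c n a \<partial>lborel)\<bar> \<le> (\<integral>a. \<bar>P n a - Q a\<bar> \<partial>lborel)" for n
  proof -
    have "(\<integral>a. P n a * c n a \<partial>lborel) - (\<integral>a. Q a * c n a \<partial>lborel) = (\<integral>a. (P n a - Q a) * c n a \<partial>lborel)"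
      using Pc Qc by (simp add: left_diff_distrib)
    also have "\<bar>\<dots>\<bar> \<le> (\<integral>a. \<bar>(P n a - Q a) * c n a\<bar> \<partial>lborel)" by (rule integral_abs_bound)
    also have "\<dots> \<le> (\<integral>a. \<bar>P n a - Q a\<bar> \<partial>lborel)"
      by (rule integral_mono') (use P Q c_bd in \<open>auto simp: abs_mult intro!: mult_left_le\<close>)
    finally show ?thesis .
  qed
  then have 2: "(\<lambda>n. (\<integral>a. P n a * c n a \<partial>lborel) - (\<integral>a. Q a * c n a \<partial>lborel)) \<longlonglongrightarrow> 0"
    by (intro Lim_null_comparison[OF _ lim]) auto
  show ?thesis using tendsto_add[OF 2 1] unfolding P_def Q_def by simp
qed

section \<open>Rescaling the configuration integral\<close>

interpretation lborel_product: product_sigma_finite "\<lambda>_::'i. lborel :: 'a::euclidean_space measure"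
  by standard

lemma nn_integral_lborel_affine:
  fixes t :: "'a::euclidean_space"
  assumes "c > 0" and [measurable]: "u \<in> borel_measurable borel"
  shows "(\<integral>\<^sup>+x. u x \<partial>lborel) = ennreal (c ^ DIM('a)) * (\<integral>\<^sup>+x. u (t + c *\<^sub>R x) \<partial>lborel)"
  by (subst lborel_affine[of c t])
    (use assms(1) in \<open>auto simp: nn_integral_density nn_integral_distr nn_integral_cmult ennreal_power\<close>)

text \<open>Induction on the number of coordinates, each contributing the factor \<open>c\<^sup>d\<close> of the one-point
  substitution.\<close>

lemma nn_integral_PiM_affine:
  fixes t :: "'a::euclidean_space"
  assumes "finite I" and c: "c > 0" and "g \<in> borel_measurable (PiM I (\<lambda>_. lborel))"
  shows "(\<integral>\<^sup>+x. g x \<partial>PiM I (\<lambda>_. lborel)) =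
    ennreal (c ^ (DIM('a) * card I)) * (\<integral>\<^sup>+y. g (\<lambda>i\<in>I. t + c *\<^sub>R y i) \<partial>PiM I (\<lambda>_. lborel :: 'a measure))"
  using assms(1,3)
proof (induction I arbitrary: g rule: finite_induct)
  case empty
  show ?case by (simp add: lborel_product.nn_integral_empty restrict_def space_PiM)
next
  case (insert j I)
  note [measurable] = insert.prems
  have ext: "(\<lambda>i\<in>I. t + c *\<^sub>R x i)(j := t + c *\<^sub>R y) = (\<lambda>i\<in>insert j I. t + c *\<^sub>R (x(j := y)) i)" for x y
    using insert.hyps by (auto simp: restrict_def fun_eq_iff)
  have "(\<integral>\<^sup>+x. g x \<partial>PiM (insert j I) (\<lambda>_. lborel)) =
      (\<integral>\<^sup>+x. \<integral>\<^sup>+y. g (x(j := y)) \<partial>lborel \<partial>PiM I (\<lambda>_. lborel))"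
    using insert.hyps by (intro lborel_product.product_nn_integral_insert) auto
  also have "\<dots> = (\<integral>\<^sup>+x. ennreal (c ^ DIM('a)) * (\<integral>\<^sup>+y. g (x(j := t + c *\<^sub>R y)) \<partial>lborel) \<partial>PiM I (\<lambda>_. lborel))"
    by (intro nn_integral_cong nn_integral_lborel_affine c) measurable
  also have "\<dots> = ennreal (c ^ DIM('a)) * (\<integral>\<^sup>+x. \<integral>\<^sup>+y. g (x(j := t + c *\<^sub>R y)) \<partial>lborel \<partial>PiM I (\<lambda>_. lborel))"
    by (intro nn_integral_cmult) measurable
  also have "(\<integral>\<^sup>+x. \<integral>\<^sup>+y. g (x(j := t + c *\<^sub>R y)) \<partial>lborel \<partial>PiM I (\<lambda>_. lborel)) =
      ennreal (c ^ (DIM('a) * card I)) *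
      (\<integral>\<^sup>+x. \<integral>\<^sup>+y. g ((\<lambda>i\<in>I. t + c *\<^sub>R x i)(j := t + c *\<^sub>R y)) \<partial>lborel \<partial>PiM I (\<lambda>_. lborel))"
    by (rule insert.IH) measurable
  also have "(\<integral>\<^sup>+x. \<integral>\<^sup>+y. g ((\<lambda>i\<in>I. t + c *\<^sub>R x i)(j := t + c *\<^sub>R y)) \<partial>lborel \<partial>PiM I (\<lambda>_. lborel)) =
      (\<integral>\<^sup>+x. g (\<lambda>i\<in>insert j I. t + c *\<^sub>R x i) \<partial>PiM (insert j I) (\<lambda>_. lborel))"
    unfolding ext using insert.hyps
    by (intro lborel_product.product_nn_integral_insert[symmetric]) auto
  finally have "(\<integral>\<^sup>+x. g x \<partial>PiM (insert j I) (\<lambda>_. lborel)) = ennreal (c ^ DIM('a)) *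
      (ennreal (c ^ (DIM('a) * card I)) * (\<integral>\<^sup>+x. g (\<lambda>i\<in>insert j I. t + c *\<^sub>R x i) \<partial>PiM (insert j I) (\<lambda>_. lborel)))" .
  moreover have "ennreal (c ^ (DIM('a) * card (insert j I))) = ennreal (c ^ DIM('a)) * ennreal (c ^ (DIM('a) * card I))"
    using insert.hyps c by (simp add: power_add ennreal_mult)
  ultimately show ?case by (simp only: mult.assoc)
qed

text \<open>The configuration of shape \<open>y\<close>, shrunk by \<open>c\<close>, whose distinguished point \<open>z\<close> is at \<open>a\<close>.\<close>

definition around :: "'i \<Rightarrow> 'i set \<Rightarrow> real \<Rightarrow> ('i \<Rightarrow> 'a::real_vector) \<Rightarrow> 'a \<Rightarrow> 'i \<Rightarrow> 'a" where
  "around z I c y a = (\<lambda>i\<in>I. a + c *\<^sub>R y i)(z := a)"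

lemma measurable_around[measurable]:
  assumes "z \<notin> I"
  shows "(\<lambda>(y, a). around z I c y a) \<in>
    measurable (PiM I (\<lambda>_. lborel) \<Otimes>\<^sub>M lborel) (PiM (insert z I) (\<lambda>_. lborel :: 'a::euclidean_space measure))"
  unfolding around_def split_beta by measurable

text \<open>The order of integration is exchanged at the end: the shape \<open>y\<close> of the configuration has to be the
  outer variable, since the limit is first taken in the position \<open>a\<close> for a fixed shape.\<close>

lemma nn_integral_PiM_around:
  fixes F :: "('i \<Rightarrow> 'a::euclidean_space) \<Rightarrow> ennreal"
  assumes I: "finite I" "z \<notin> I" and c: "c > 0"
    and F[measurable]: "F \<in> borel_measurable (PiM (insert z I) (\<lambda>_. lborel))"
  shows "(\<integral>\<^sup>+x. F x \<partial>PiM (insert z I) (\<lambda>_. lborel)) =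
    ennreal (c ^ (DIM('a) * card I)) *
    (\<integral>\<^sup>+y. \<integral>\<^sup>+a. F (around z I c y a) \<partial>lborel \<partial>PiM I (\<lambda>_. lborel))"
proof -
  note [measurable] = measurable_around[OF I(2)]
  interpret finite_product_sigma_finite "\<lambda>_::'i. lborel :: 'a measure" I by standard fact
  interpret P: pair_sigma_finite "PiM I (\<lambda>_. lborel :: 'a measure)" "lborel :: 'a measure" by standard
  have [measurable]: "(\<lambda>(y, a). F (around z I c y a)) \<in> borel_measurable (PiM I (\<lambda>_. lborel) \<Otimes>\<^sub>M lborel)"
    using measurable_compose[OF measurable_around[OF I(2), of c] F] by (simp add: split_beta)
  have "(\<integral>\<^sup>+x. F x \<partial>PiM (insert z I) (\<lambda>_. lborel)) =
      (\<integral>\<^sup>+a. \<integral>\<^sup>+x. F (x(z := a)) \<partial>PiM I (\<lambda>_. lborel) \<partial>lborel)"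
    using I by (intro lborel_product.product_nn_integral_insert_rev) auto
  also have "\<dots> = (\<integral>\<^sup>+a. ennreal (c ^ (DIM('a) * card I)) *
      (\<integral>\<^sup>+y. F (around z I c y a) \<partial>PiM I (\<lambda>_. lborel)) \<partial>lborel)"
    unfolding around_def by (intro nn_integral_cong nn_integral_PiM_affine I c) measurable
  also have "\<dots> = ennreal (c ^ (DIM('a) * card I)) *
      (\<integral>\<^sup>+a. \<integral>\<^sup>+y. F (around z I c y a) \<partial>PiM I (\<lambda>_. lborel) \<partial>lborel)"
    by (intro nn_integral_cmult) measurable
  also have "(\<integral>\<^sup>+a. \<integral>\<^sup>+y. F (around z I c y a) \<partial>PiM I (\<lambda>_. lborel) \<partial>lborel) =
      (\<integral>\<^sup>+y. \<integral>\<^sup>+a. F (around z I c y a) \<partial>lborel \<partial>PiM I (\<lambda>_. lborel))"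
    by (intro P.Fubini') measurable
  finally show ?thesis .
qed

section \<open>Proximity graphs on an index set\<close>

text \<open>The edges of \<^const>\<open>geom_graph\<close> read on the indices of the points. Unlike the geometric
  graph it lives on a vertex set that does not vary with the points, so that only finitely many graphs
  occur and one can sum over them.\<close>

definition proximity_edges :: "'i set \<Rightarrow> ('i \<Rightarrow> 'a::metric_space) \<Rightarrow> real \<Rightarrow> 'i set set" where
  "proximity_edges V x r = {{i, j} | i j. i \<in> V \<and> j \<in> V \<and> i \<noteq> j \<and> dist (x i) (x j) \<le> r}"

lemma doubleton_in_proximity_edges:
  "{i, j} \<in> proximity_edges V x r \<longleftrightarrow> i \<in> V \<and> j \<in> V \<and> i \<noteq> j \<and> dist (x i) (x j) \<le> r"
  by (auto simp: proximity_edges_def doubleton_eq_iff dist_commute)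

lemma proximity_edges_pairs: "e \<in> proximity_edges V x r \<Longrightarrow> e \<subseteq> V \<and> card e = 2"
  by (auto simp: proximity_edges_def)

lemma pair_set_cases:
  assumes "e \<subseteq> V \<and> card e = 2"
  obtains i j where "e = {i, j}" "i \<in> V" "j \<in> V" "i \<noteq> j"
  using assms by (auto simp: card_2_iff)

lemma pair_sets_eqI:
  assumes "\<And>e. e \<in> G \<Longrightarrow> e \<subseteq> V \<and> card e = 2" "\<And>e. e \<in> H \<Longrightarrow> e \<subseteq> V \<and> card e = 2"
    and "\<And>i j. i \<in> V \<Longrightarrow> j \<in> V \<Longrightarrow> i \<noteq> j \<Longrightarrow> {i, j} \<in> G \<longleftrightarrow> {i, j} \<in> H"
  shows "G = H"
proof (intro set_eqI)
  fix e show "e \<in> G \<longleftrightarrow> e \<in> H"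
    using assms by (metis (no_types, lifting) pair_set_cases)
qed

lemma proximity_edges_cong:
  assumes "\<And>i j. i \<in> V \<Longrightarrow> j \<in> V \<Longrightarrow> i \<noteq> j \<Longrightarrow> dist (x i) (x j) \<le> r \<longleftrightarrow> dist (y i) (y j) \<le> s"
  shows "proximity_edges V x r = proximity_edges V y s"
  by (rule pair_sets_eqI[of _ V])
    (use assms in \<open>auto simp: doubleton_in_proximity_edges dest: proximity_edges_pairs\<close>)

text \<open>Scale invariance: the graph at radius \<open>c\<close> depends only on the shape of the configuration. This is why the radius
  disappears from the limit.\<close>

lemma proximity_edges_around:
  fixes y :: "'i \<Rightarrow> 'a::euclidean_space"
  assumes "z \<notin> I" "c > 0"
  shows "proximity_edges (insert z I) (around z I c y a) c = proximity_edges (insert z I) (y(z := 0)) 1"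
proof (rule proximity_edges_cong)
  fix i j assume "i \<in> insert z I" "j \<in> insert z I" "i \<noteq> j"
  have "around z I c y a i - around z I c y a j = c *\<^sub>R ((y(z := 0)) i - (y(z := 0)) j)"
    using \<open>i \<in> _\<close> \<open>j \<in> _\<close> \<open>i \<noteq> j\<close> by (auto simp: around_def algebra_simps)
  then have "dist (around z I c y a i) (around z I c y a j) = c * dist ((y(z := 0)) i) ((y(z := 0)) j)"
    using \<open>c > 0\<close> by (simp only: dist_norm norm_scaleR)
  then show "dist (around z I c y a i) (around z I c y a j) \<le> c \<longleftrightarrow> dist ((y(z := 0)) i) ((y(z := 0)) j) \<le> 1"
    using \<open>c > 0\<close> by (metis mult.right_neutral mult_le_cancel_left_pos)
qed

lemma proximity_edges_eq_iff:
  "proximity_edges V x r = G \<longleftrightarrow> (\<forall>e\<in>G. e \<subseteq> V \<and> card e = 2) \<and>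
     (\<forall>i\<in>V. \<forall>j\<in>V. i \<noteq> j \<longrightarrow> (dist (x i) (x j) \<le> r \<longleftrightarrow> {i, j} \<in> G))" (is "?l \<longleftrightarrow> ?r")
proof
  assume ?l then show ?r
    using proximity_edges_pairs doubleton_in_proximity_edges by (metis (no_types, lifting))
next
  assume ?r
  show ?l
    by (rule pair_sets_eqI[of _ V])
      (use \<open>?r\<close> in \<open>auto simp: doubleton_in_proximity_edges dest: proximity_edges_pairs\<close>)
qed

lemma measurable_proximity_edges_eq:
  fixes x :: "'i \<Rightarrow> 'w \<Rightarrow> 'a::euclidean_space"
  assumes "finite V" and [measurable]: "\<And>i. i \<in> V \<Longrightarrow> x i \<in> borel_measurable N"
  shows "Measurable.pred N (\<lambda>\<omega>. proximity_edges V (\<lambda>i. x i \<omega>) r = G)"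
proof (cases "\<forall>e\<in>G. e \<subseteq> V \<and> card e = 2")
  case True
  have "Measurable.pred N (\<lambda>\<omega>. \<forall>i\<in>V. \<forall>j\<in>V. i \<noteq> j \<longrightarrow> (dist (x i \<omega>) (x j \<omega>) \<le> r \<longleftrightarrow> {i, j} \<in> G))"
    by (intro pred_intros_finite assms(1) pred_intros_logic) measurable
  with True show ?thesis unfolding proximity_edges_eq_iff by simp
next
  case False
  then have "(\<lambda>\<omega>. proximity_edges V (\<lambda>i. x i \<omega>) r = G) = (\<lambda>_. False)"
    unfolding proximity_edges_eq_iff by (simp only: simp_thms)
  then show ?thesis by simp
qed

section \<open>The left-most point\<close>

lemma leftmost_in_image:
  "leftmost_in A (x ` V) \<longleftrightarrow> (\<exists>i\<in>V. x i \<in> A \<and> (\<forall>j\<in>V. first_coord (x i) \<le> first_coord (x j)))"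
  by (auto simp: leftmost_in_def)

lemma measurable_first_coord[measurable]:
  "(first_coord :: real ^ 'd::{finite, linorder} \<Rightarrow> real) \<in> borel_measurable borel"
  unfolding first_coord_def by (intro borel_measurable_continuous_onI continuous_intros)

lemma measurable_leftmost_in_image:
  fixes x :: "'i \<Rightarrow> 'w \<Rightarrow> real ^ 'd::{finite, linorder}"
  assumes "finite V" and [measurable]: "\<And>i. i \<in> V \<Longrightarrow> x i \<in> borel_measurable N"
    and [measurable]: "A \<in> sets borel"
  shows "Measurable.pred N (\<lambda>\<omega>. leftmost_in A ((\<lambda>i. x i \<omega>) ` V))"
  unfolding leftmost_in_image
  by (intro pred_intros_logic pred_intros_finite assms(1)) measurable

lemma leftmost_in_subset:
  assumes "finite S" "S \<noteq> {}" "S \<subseteq> A" shows "leftmost_in A S"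
proof -
  obtain x where "x \<in> S" "\<forall>y\<in>S. first_coord x \<le> first_coord y"
    using ex_min_if_finite[of "first_coord ` S"] assms by (auto simp: not_less) 
  then show ?thesis using assms unfolding leftmost_in_def by auto
qed

text \<open>All points of the configuration tend to \<open>a\<close>, and \<open>a\<close> is interior to \<open>A\<close> or to its complement.\<close>

lemma leftmost_in_around_tendsto:
  fixes y :: "'i \<Rightarrow> real ^ 'd::{finite, linorder}"
  assumes "open A" "r \<longlonglongrightarrow> 0" "finite I" "a \<notin> frontier A"
  shows "(\<lambda>n. of_bool (leftmost_in A (around z I (r n) y a ` insert z I))) \<longlonglongrightarrow> (indicator A a :: real)"
proof -
  have lim: "(\<lambda>n. around z I (r n) y a i) \<longlonglongrightarrow> a" if "i \<in> insert z I" for i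
  proof (cases "i = z")
    case False
    have "(\<lambda>n. a + r n *\<^sub>R y i) \<longlonglongrightarrow> a + 0 *\<^sub>R y i" by (intro tendsto_intros assms)
    then show ?thesis using False that by (simp add: around_def)
  qed (simp add: around_def)
  have ev: "eventually (\<lambda>n. \<forall>i\<in>insert z I. around z I (r n) y a i \<in> U) sequentially" if "open U" "a \<in> U" for U
    using topological_tendstoD[OF lim that] assms(3) by (intro eventually_ball_finite) auto
  show ?thesis
  proof (cases "a \<in> A")
    case True
    from ev[OF \<open>open A\<close> True] show ?thesis
      by (intro tendsto_eventually, elim eventually_mono) (use assms(3) True in \<open>auto intro!: leftmost_in_subset\<close>)
  next
    case False
    then have "a \<in> - closure A"
      using assms(1,4) by (auto simp: frontier_def interior_open)
    with ev[of "- closure A"] have "eventually (\<lambda>n. \<forall>i\<in>insert z I. around z I (r n) y a i \<in> - closure A) sequentially"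
      by auto
    then have "eventually (\<lambda>n. \<not> leftmost_in A (around z I (r n) y a ` insert z I)) sequentially"
      by (elim eventually_mono) (use closure_subset[of A] in \<open>auto simp: leftmost_in_def\<close>)
    with False show ?thesis
      by (intro tendsto_eventually) (auto elim!: eventually_mono)
  qed
qed

section \<open>The limit of the configuration integral\<close>

text \<open>Along each edge the norm grows by at most \<open>1\<close>.\<close>

lemma connected_norm_bound:
  fixes x :: "'i \<Rightarrow> 'a::real_normed_vector"
  assumes "proximity_edges V x 1 = G" "(z, i) \<in> {(u, v). {u, v} \<in> G} ^^ n" "x z = 0"
  shows "norm (x i) \<le> n"
  using assms(2)
proof (induction n arbitrary: i)
  case 0 then show ?case using assms(3) by simp
next
  case (Suc n)
  then obtain j where j: "(z, j) \<in> {(u, v). {u, v} \<in> G} ^^ n" "{j, i} \<in> G" by auto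
  have "norm (x i) \<le> norm (x j) + dist (x j) (x i)"
    using norm_triangle_ineq[of "x j" "x i - x j"] by (simp add: dist_norm norm_minus_commute)
  moreover have "dist (x j) (x i) \<le> 1"
    using j(2) assms(1) doubleton_in_proximity_edges[of j i V x 1] by simp
  ultimately show ?case using Suc.IH[OF j(1)] by simp
qed

text \<open>The shapes \<open>y\<close> that, together with the origin as the point \<open>z\<close>, span \<open>G\<close> at radius \<open>1\<close>.\<close>

definition config_set :: "'i \<Rightarrow> 'i set \<Rightarrow> 'i set set \<Rightarrow> ('i \<Rightarrow> 'a::euclidean_space) set" where
  "config_set z I G = {y \<in> space (PiM I (\<lambda>_. lborel)). proximity_edges (insert z I) (y(z := 0)) 1 = G}"

lemma config_set_sets[measurable]:
  assumes "finite I"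
  shows "config_set z I G \<in> sets (PiM I (\<lambda>_. lborel :: 'a::euclidean_space measure))"
proof -
  have "Measurable.pred (PiM I (\<lambda>_. lborel :: 'a measure))
      (\<lambda>y. proximity_edges (insert z I) (y(z := 0)) 1 = G)"
  proof (rule measurable_proximity_edges_eq)
    fix i assume "i \<in> insert z I"
    then show "(\<lambda>y. (y(z := 0)) i) \<in> borel_measurable (PiM I (\<lambda>_. lborel :: 'a measure))"
      by (cases "i = z") (auto simp: measurable_component_singleton)
  qed (use assms in simp)
  then show ?thesis unfolding config_set_def by (simp add: pred_def)
qed

text \<open>Connectedness keeps every point within a distance of the origin that depends only on \<open>G\<close>, so
  that the configurations fit into a product of balls. In a disconnected graph a component could move off to infinity.\<close>

lemma emeasure_config_set_finite:
  fixes z :: 'i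
  assumes "finite I" "z \<notin> I"
    and conn: "\<And>i. i \<in> I \<Longrightarrow> (z, i) \<in> {(u, v). {u, v} \<in> G}\<^sup>*"
  shows "emeasure (PiM I (\<lambda>_. lborel :: 'a::euclidean_space measure)) (config_set z I G) < \<infinity>"
proof -
  have "\<forall>i\<in>I. \<exists>n. (z, i) \<in> {(u, v). {u, v} \<in> G} ^^ n"
    using conn rtrancl_imp_relpow by blast
  then obtain N where N: "\<And>i. i \<in> I \<Longrightarrow> (z, i) \<in> {(u, v). {u, v} \<in> G} ^^ N i" by metis
  have "config_set z I G \<subseteq> (\<Pi>\<^sub>E i\<in>I. cball (0::'a) (real (N i)))"
  proof
    fix y :: "'i \<Rightarrow> 'a" assume y: "y \<in> config_set z I G"
    have "norm (y i) \<le> N i" if "i \<in> I" for i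
      using connected_norm_bound[OF _ N[OF that], of "insert z I" "y(z := 0)"] y that assms(2)
      by (auto simp: config_set_def split: if_splits)
    with y show "y \<in> (\<Pi>\<^sub>E i\<in>I. cball 0 (real (N i)))"
      by (auto simp: config_set_def space_PiM PiE_iff)
  qed
  then have "emeasure (PiM I (\<lambda>_. lborel :: 'a measure)) (config_set z I G) \<le>
      emeasure (PiM I (\<lambda>_. lborel :: 'a measure)) (\<Pi>\<^sub>E i\<in>I. cball (0::'a) (real (N i)))"
    using assms(1) by (intro emeasure_mono) (auto intro!: sets_PiM_I_finite)
  also have "\<dots> = (\<Prod>i\<in>I. emeasure lborel (cball (0::'a) (real (N i))))"
    using assms(1) by (intro lborel_product.emeasure_PiM) auto
  also have "\<dots> < \<infinity>"
    using emeasure_lborel_cball_finite[where 'a = 'a, THEN less_imp_neq]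
    by (auto simp: less_top[symmetric] ennreal_prod_eq_top)
  finally show ?thesis .
qed

text \<open>The probability that independent points with density \<open>f\<close>, one for each element of \<open>V\<close>, span
  \<open>G\<close> at radius \<open>r\<close> and have their left-most point in \<open>A\<close>.\<close>

definition config_integral ::
  "(real ^ 'd::{finite, linorder} \<Rightarrow> real) \<Rightarrow> (real ^ 'd::{finite, linorder}) set \<Rightarrow> 'i set \<Rightarrow> 'i set set \<Rightarrow> real \<Rightarrow> real" where
  "config_integral f A V G r = (\<integral>x. (\<Prod>i\<in>V. f (x i)) *
     of_bool (proximity_edges V x r = G \<and> leftmost_in A (x ` V)) \<partial>PiM V (\<lambda>_. lborel))"

lemma measurable_config_integrand:
  fixes f :: "real ^ 'd::{finite, linorder} \<Rightarrow> real"
  assumes "finite V" and [measurable]: "f \<in> borel_measurable borel" and A: "A \<in> sets borel"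
  shows "(\<lambda>x. (\<Prod>i\<in>V. f (x i)) * of_bool (proximity_edges V x r = G \<and> leftmost_in A (x ` V)))
    \<in> borel_measurable (PiM V (\<lambda>_. lborel))"
proof -
  have comp: "(\<lambda>x. x i) \<in> borel_measurable (PiM V (\<lambda>_. lborel :: (real ^ 'd::{finite, linorder}) measure))" if "i \<in> V" for i
    using measurable_component_singleton[OF that, of "\<lambda>_. lborel :: (real ^ 'd::{finite, linorder}) measure"] by simp
  have [measurable]: "Measurable.pred (PiM V (\<lambda>_. lborel :: (real ^ 'd::{finite, linorder}) measure)) (\<lambda>x. proximity_edges V x r = G)"
    by (rule measurable_proximity_edges_eq[OF assms(1), of "\<lambda>i x. x i", OF comp])
  have [measurable]: "Measurable.pred (PiM V (\<lambda>_. lborel :: (real ^ 'd::{finite, linorder}) measure)) (\<lambda>x. leftmost_in A (x ` V))"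
    by (rule measurable_leftmost_in_image[OF assms(1), of "\<lambda>i x. x i", OF comp A])
  show ?thesis by measurable
qed

text \<open>The heart of the argument. After the substitution the integrand factors, for each fixed shape
  \<open>y\<close>, into the indicator that \<open>y\<close> spans \<open>G\<close> and a position integral \<open>J n y\<close> that converges to the
  integral of \<open>f\<^sup>k\<close> over \<open>A\<close>. The boundedness of \<open>f\<close> bounds \<open>J n y\<close> uniformly, and the finite volume of the admissible
  shapes then permits dominated convergence in \<open>y\<close>.\<close>

lemma config_integral_tendsto:
  fixes f :: "real ^ 'd::{finite, linorder} \<Rightarrow> real" and z :: 'i
  assumes f: "integrable lborel f" and nonneg: "\<And>x. 0 \<le> f x" and bound: "\<And>x. f x \<le> B"
    and A: "open A" "frontier A \<in> null_sets lborel"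
    and r: "r \<longlonglongrightarrow> 0" "\<And>n. n \<ge> 1 \<Longrightarrow> 0 < r n"
    and I: "finite I" "z \<notin> I"
    and conn: "\<And>i. i \<in> I \<Longrightarrow> (z, i) \<in> {(u, v). {u, v} \<in> G}\<^sup>*"
  shows "(\<lambda>n. config_integral f A (insert z I) G (r n) / r n ^ (CARD('d) * card I)) \<longlonglongrightarrow>
    (\<integral>a. f a ^ Suc (card I) * indicator A a \<partial>lborel) *
      measure (PiM I (\<lambda>_. lborel :: (real ^ 'd::{finite, linorder}) measure)) (config_set z I G)"
proof -
  let ?L = "\<lambda>I::'i set. PiM I (\<lambda>_. lborel :: (real ^ 'd::{finite, linorder}) measure)"
  have [measurable]: "f \<in> borel_measurable borel" using f by (auto dest: borel_measurable_integrable)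
  have Am[measurable]: "A \<in> sets borel" using A by simp
  have B: "0 \<le> B" using nonneg bound by (rule order_trans)
  define V where "V = insert z I"
  define F where "F n x = (\<Prod>i\<in>V. f (x i)) * of_bool (proximity_edges V x (r n) = G \<and> leftmost_in A (x ` V))" for n x
  define c where "c n y a = (of_bool (leftmost_in A (around z I (r n) y a ` insert z I)) :: real)" for n y a
  define J where "J n y = (\<integral>a. f a * (\<Prod>i\<in>I. f (a + r n *\<^sub>R y i)) * c n y a \<partial>lborel)" for n y
  define J0 where "J0 = (\<integral>a. f a ^ Suc (card I) * indicator A a \<partial>lborel)"
  define S :: "('i \<Rightarrow> real ^ 'd::{finite, linorder}) set" where "S = config_set z I G"
  have S[measurable]: "S \<in> sets (?L I)" unfolding S_def using I(1) by (rule config_set_sets)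
  have S_fin: "emeasure (?L I) S < \<infinity>"
    unfolding S_def using I conn by (rule emeasure_config_set_finite)
  have FM[measurable]: "F n \<in> borel_measurable (?L V)" for n
    unfolding F_def using I by (intro measurable_config_integrand) (auto simp: V_def)
  have F_nonneg: "0 \<le> F n x" for n x
    unfolding F_def using nonneg by (simp add: prod_nonneg)
  have c_meas: "c n y \<in> borel_measurable borel" for n y
  proof -
    have "Measurable.pred borel (\<lambda>a. leftmost_in A ((\<lambda>i. around z I (r n) y a i) ` insert z I))"
    proof (intro measurable_leftmost_in_image)
      fix i assume "i \<in> insert z I"
      then show "(\<lambda>a. around z I (r n) y a i) \<in> borel_measurable borel"
        by (cases "i = z") (auto simp: around_def)
    qed (use I(1) in auto)
    then show ?thesis unfolding c_def by measurable
  qed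
  have F_around: "F n (around z I (r n) y a) =
      indicator S y * (f a * (\<Prod>i\<in>I. f (a + r n *\<^sub>R y i)) * c n y a)"
    if "n \<ge> 1" "y \<in> space (?L I)" for n y a
  proof -
    have "(\<Prod>i\<in>V. f (around z I (r n) y a i)) = f a * (\<Prod>i\<in>I. f (a + r n *\<^sub>R y i))"
      unfolding V_def using I
      by (subst prod.insert) (auto simp: around_def intro!: prod.cong)
    then show ?thesis
      using proximity_edges_around[OF I(2) r(2)[OF that(1)], of y a] that(2)
      by (simp add: F_def c_def V_def S_def config_set_def indicator_def)
  qed
  have bdint: "integrable lborel (\<lambda>a. f a * B ^ card I)" using f by simp
  have term_nonneg: "0 \<le> f a * (\<Prod>i\<in>I. f (a + r n *\<^sub>R y i)) * c n y a" for n y a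
    using nonneg by (simp add: prod_nonneg c_def)
  have term_bd: "f a * (\<Prod>i\<in>I. f (a + r n *\<^sub>R y i)) * c n y a \<le> f a * B ^ card I" for n y a
  proof -
    have "(\<Prod>i\<in>I. f (a + r n *\<^sub>R y i)) \<le> (\<Prod>i\<in>I. B)"
      by (intro prod_mono) (auto simp: nonneg bound)
    then have "f a * (\<Prod>i\<in>I. f (a + r n *\<^sub>R y i)) \<le> f a * B ^ card I"
      by (intro mult_left_mono) (auto simp: nonneg)
    moreover have "0 \<le> f a * (\<Prod>i\<in>I. f (a + r n *\<^sub>R y i))" by (simp add: nonneg prod_nonneg)
    ultimately show ?thesis by (auto simp: c_def nonneg B)
  qed
  have term_int: "integrable lborel (\<lambda>a. f a * (\<Prod>i\<in>I. f (a + r n *\<^sub>R y i)) * c n y a)" for n y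
    by (rule Bochner_Integration.integrable_bound[OF bdint])
      (use c_meas term_nonneg term_bd B nonneg in \<open>auto simp: abs_of_nonneg\<close>)
  have J_nonneg: "0 \<le> J n y" for n y unfolding J_def by (simp add: term_nonneg)
  have J_bd: "J n y \<le> B ^ card I * (\<integral>a. f a \<partial>lborel)" for n y
    unfolding J_def using integral_mono[OF term_int bdint term_bd] by (simp add: mult.commute)
  have J_lim: "(\<lambda>n. J n y) \<longlonglongrightarrow> J0" for y
    unfolding J_def J0_def
  proof (rule prod_translates_indicator_tendsto[OF f nonneg bound r(1) I(1) c_meas])
    have "AE a in lborel. a \<notin> frontier A" using A(2) by (rule AE_not_in)
    then show "AE a in lborel. (\<lambda>n. c n y a) \<longlonglongrightarrow> indicator A a"
      unfolding c_def by eventually_elim (rule leftmost_in_around_tendsto[OF A(1) r(1) I(1)])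
  qed (auto simp: c_def)
  define W where "W n y = (\<integral>a. F n (around z I (r n) y a) \<partial>lborel)" for n y
  have W_eq: "W n y = indicator S y * J n y" if "n \<ge> 1" "y \<in> space (?L I)" for n y
    unfolding W_def F_around[OF that] J_def by simp
  have Fm2: "(\<lambda>(y, a). F n (around z I (r n) y a)) \<in> borel_measurable (?L I \<Otimes>\<^sub>M lborel)" for n
    using measurable_compose[OF measurable_around[OF I(2), of "r n"] FM[unfolded V_def]]
    by (simp add: split_beta)
  have W_meas: "W n \<in> borel_measurable (?L I)" for n
    unfolding W_def by (rule lborel.borel_measurable_lebesgue_integral[OF Fm2])
  have eq: "config_integral f A (insert z I) G (r n) = r n ^ (CARD('d) * card I) * (\<integral>y. W n y \<partial>?L I)"
    if n: "n \<ge> 1" for n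
  proof -
    have rn: "r n > 0" using r(2)[OF n] .
    have W_nonneg: "0 \<le> W n y" for y unfolding W_def by (simp add: F_nonneg)
    have "(\<integral>\<^sup>+x. F n x \<partial>?L V) = ennreal (r n ^ (CARD('d) * card I)) *
        (\<integral>\<^sup>+y. \<integral>\<^sup>+a. F n (around z I (r n) y a) \<partial>lborel \<partial>?L I)"
      unfolding V_def
      by (subst nn_integral_PiM_around[OF I rn]) (use FM[of n] in \<open>auto simp: V_def\<close>)
    also have "(\<integral>\<^sup>+y. \<integral>\<^sup>+a. F n (around z I (r n) y a) \<partial>lborel \<partial>?L I) = (\<integral>\<^sup>+y. W n y \<partial>?L I)"
    proof (rule nn_integral_cong)
      fix y assume y: "y \<in> space (?L I)"
      show "(\<integral>\<^sup>+a. F n (around z I (r n) y a) \<partial>lborel) = ennreal (W n y)"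
        unfolding W_def F_around[OF n y]
        by (intro nn_integral_eq_integral integrable_mult_right term_int AE_I2 mult_nonneg_nonneg term_nonneg) simp
    qed
    finally have "enn2real (\<integral>\<^sup>+x. F n x \<partial>?L V) = r n ^ (CARD('d) * card I) * enn2real (\<integral>\<^sup>+y. W n y \<partial>?L I)"
      using rn by (simp add: enn2real_mult)
    moreover have "config_integral f A (insert z I) G (r n) = enn2real (\<integral>\<^sup>+x. F n x \<partial>?L V)"
      unfolding config_integral_def F_def[symmetric] V_def[symmetric]
      by (rule integral_eq_nn_integral) (use FM F_nonneg in auto)
    moreover have "(\<integral>y. W n y \<partial>?L I) = enn2real (\<integral>\<^sup>+y. W n y \<partial>?L I)"
      by (rule integral_eq_nn_integral) (use W_meas W_nonneg in auto)
    ultimately show ?thesis by simp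
  qed
  have S_int: "integrable (?L I) (\<lambda>y. indicator S y * (C::real))" for C
    using S_fin S by simp
  \<comment> \<open>The sequence is shifted by one because \<open>r\<close> is positive only from index \<open>1\<close> on.\<close>
  have "(\<lambda>n. \<integral>y. W (Suc n) y \<partial>?L I) \<longlonglongrightarrow> (\<integral>y. indicator S y * J0 \<partial>?L I)"
  proof (rule integral_dominated_convergence[OF _ W_meas S_int[of "B ^ card I * (\<integral>a. f a \<partial>lborel)"]])
    show "AE y in ?L I. (\<lambda>n. W (Suc n) y) \<longlonglongrightarrow> indicator S y * J0"
      by (rule AE_I2) (auto simp: W_eq intro!: tendsto_mult_left LIMSEQ_Suc J_lim)
    show "AE y in ?L I. norm (W (Suc n) y) \<le> indicator S y * (B ^ card I * (\<integral>a. f a \<partial>lborel))" for n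
      by (rule AE_I2) (auto simp: W_eq abs_mult J_nonneg J_bd intro!: mult_left_mono)
  qed measurable
  then have "(\<lambda>n. \<integral>y. W n y \<partial>?L I) \<longlonglongrightarrow> J0 * measure (?L I) S"
    using S_fin by (simp add: filterlim_sequentially_Suc[of "\<lambda>n. \<integral>y. W n y \<partial>?L I"] mult.commute Int_absorb2 sets.sets_into_space[OF S])
  moreover have "eventually (\<lambda>n. (\<integral>y. W n y \<partial>?L I) =
      config_integral f A (insert z I) G (r n) / r n ^ (CARD('d) * card I)) sequentially"
    using eventually_ge_at_top[of 1] by eventually_elim (use eq r(2) in \<open>force simp: less_imp_neq[symmetric]\<close>)
  ultimately show ?thesis
    unfolding J0_def[symmetric] S_def[symmetric] by (rule Lim_transform_eventually)
qed

section \<open>Counting induced copies\<close>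

lemma graph_iso_sym:
  assumes "graph_iso G H" shows "graph_iso H G"
proof -
  obtain \<phi> where \<phi>: "bij_betw \<phi> (verts G) (verts H)"
      "\<forall>u\<in>verts G. \<forall>v\<in>verts G. {u, v} \<in> edges G \<longleftrightarrow> {\<phi> u, \<phi> v} \<in> edges H"
    using assms unfolding graph_iso_def by blast
  let ?\<psi> = "inv_into (verts G) \<phi>"
  have "bij_betw ?\<psi> (verts H) (verts G)" by (rule bij_betw_inv_into[OF \<phi>(1)])
  moreover have "{u, v} \<in> edges H \<longleftrightarrow> {?\<psi> u, ?\<psi> v} \<in> edges G" if "u \<in> verts H" "v \<in> verts H" for u v
    using \<phi>(2)[rule_format, of "?\<psi> u" "?\<psi> v"] that \<phi>(1) calculation
    by (auto simp: bij_betw_inv_into_right bij_betwE)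
  ultimately show ?thesis unfolding graph_iso_def by blast
qed

lemma graph_iso_trans:
  assumes "graph_iso G H" "graph_iso H K" shows "graph_iso G K"
proof -
  obtain \<phi> where \<phi>: "bij_betw \<phi> (verts G) (verts H)"
      "\<forall>u\<in>verts G. \<forall>v\<in>verts G. {u, v} \<in> edges G \<longleftrightarrow> {\<phi> u, \<phi> v} \<in> edges H"
    using assms unfolding graph_iso_def by blast
  obtain \<psi> where \<psi>: "bij_betw \<psi> (verts H) (verts K)"
      "\<forall>u\<in>verts H. \<forall>v\<in>verts H. {u, v} \<in> edges H \<longleftrightarrow> {\<psi> u, \<psi> v} \<in> edges K"
    using assms unfolding graph_iso_def by blast
  have "bij_betw (\<psi> \<circ> \<phi>) (verts G) (verts K)" using \<phi>(1) \<psi>(1) by (rule bij_betw_trans)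
  moreover have "\<forall>u\<in>verts G. \<forall>v\<in>verts G. {u, v} \<in> edges G \<longleftrightarrow> {(\<psi> \<circ> \<phi>) u, (\<psi> \<circ> \<phi>) v} \<in> edges K"
    using \<phi> \<psi>(2) by (auto simp: bij_betwE)
  ultimately show ?thesis unfolding graph_iso_def by blast
qed

lemma graph_iso_cong:
  assumes "graph_iso G H" shows "graph_iso G \<Gamma> \<longleftrightarrow> graph_iso H \<Gamma>"
  using graph_iso_trans[OF assms, of \<Gamma>] graph_iso_trans[OF graph_iso_sym[OF assms], of \<Gamma>] by blast

lemma graph_iso_card_verts: "graph_iso G H \<Longrightarrow> card (verts G) = card (verts H)"
  unfolding graph_iso_def by (auto dest: bij_betw_same_card)

lemma graph_iso_card_edges:
  assumes "simple_graph G" "simple_graph H" "graph_iso G H"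
  shows "card (edges G) = card (edges H)"
proof -
  obtain \<phi> where \<phi>: "bij_betw \<phi> (verts G) (verts H)"
      "\<forall>u\<in>verts G. \<forall>v\<in>verts G. {u, v} \<in> edges G \<longleftrightarrow> {\<phi> u, \<phi> v} \<in> edges H"
    using assms(3) unfolding graph_iso_def by blast
  have G: "e \<subseteq> verts G \<and> card e = 2" if "e \<in> edges G" for e
    using that assms(1) by (auto simp: simple_graph_def)
  have H: "e \<subseteq> verts H \<and> card e = 2" if "e \<in> edges H" for e
    using that assms(2) by (auto simp: simple_graph_def)
  have "bij_betw (image \<phi>) (edges G) (edges H)"
  proof (rule bij_betw_imageI)
    show "inj_on (image \<phi>) (edges G)"
      using inj_on_image_Pow[OF bij_betw_imp_inj_on[OF \<phi>(1)]] by (rule inj_on_subset) (use G in auto)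
    show "image \<phi> ` edges G = edges H"
    proof (intro equalityI subsetI)
      fix e assume "e \<in> image \<phi> ` edges G"
      then obtain e' where e': "e' \<in> edges G" "e = \<phi> ` e'" by auto
      obtain u v where "e' = {u, v}" "u \<in> verts G" "v \<in> verts G" using G[OF e'(1)] by (rule pair_set_cases)
      then show "e \<in> edges H" using e' \<phi>(2) by auto
    next
      fix e assume e: "e \<in> edges H"
      obtain u v where uv: "e = {u, v}" "u \<in> verts H" "v \<in> verts H" using H[OF e] by (rule pair_set_cases)
      then have "u \<in> \<phi> ` verts G" "v \<in> \<phi> ` verts G"
        unfolding bij_betw_imp_surj_on[OF \<phi>(1)] by simp_all
      then obtain u' v' where uv': "u' \<in> verts G" "v' \<in> verts G" "u = \<phi> u'" "v = \<phi> v'" by blast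
      then have "{u', v'} \<in> edges G" using \<phi>(2) uv(1) e by simp
      moreover have "e = \<phi> ` {u', v'}" using uv(1) uv' by simp
      ultimately show "e \<in> image \<phi> ` edges G" by (rule rev_image_eqI)
    qed
  qed
  then show ?thesis by (rule bij_betw_same_card)
qed

lemma graph_iso_induced_image:
  assumes "inj_on \<psi> S" "\<And>u v. u \<in> S \<Longrightarrow> v \<in> S \<Longrightarrow> {u, v} \<in> edges G \<longleftrightarrow> {\<psi> u, \<psi> v} \<in> edges G'"
  shows "graph_iso (induced G S) (induced G' (\<psi> ` S))"
  unfolding graph_iso_def
  by (intro exI[of _ \<psi>]) (use assms in \<open>auto simp: induced_def bij_betw_def\<close>)

text \<open>Transport of a count along an injection of the vertices. It is used twice: from the index graph to
  the percolated graph when the points are distinct, and between the percolated graphs of two outcomes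
  that show the same pattern.\<close>

lemma card_induced_copies_eq:
  assumes inj: "inj_on \<psi> (verts G)" and verts: "verts G' = \<psi> ` verts G"
    and edges: "\<And>u v. u \<in> verts G \<Longrightarrow> v \<in> verts G \<Longrightarrow> {u, v} \<in> edges G \<longleftrightarrow> {\<psi> u, \<psi> v} \<in> edges G'"
    and P: "\<And>S. S \<subseteq> verts G \<Longrightarrow> P S \<longleftrightarrow> P' (\<psi> ` S)"
  shows "card {S. S \<subseteq> verts G \<and> graph_iso (induced G S) \<Gamma> \<and> P S} =
    card {S. S \<subseteq> verts G' \<and> graph_iso (induced G' S) \<Gamma> \<and> P' S}"
proof (rule bij_betw_same_card[of "image \<psi>"], rule bij_betw_imageI)
  have iso: "graph_iso (induced G S) \<Gamma> \<longleftrightarrow> graph_iso (induced G' (\<psi> ` S)) \<Gamma>" if "S \<subseteq> verts G" for S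
  proof (rule graph_iso_cong, rule graph_iso_induced_image)
    show "inj_on \<psi> S" using inj that by (rule inj_on_subset)
  qed (use that edges in blast)
  show "inj_on (image \<psi>) {S. S \<subseteq> verts G \<and> graph_iso (induced G S) \<Gamma> \<and> P S}"
    using inj_on_image_Pow[OF inj] by (rule inj_on_subset) auto
  show "image \<psi> ` {S. S \<subseteq> verts G \<and> graph_iso (induced G S) \<Gamma> \<and> P S} =
      {S. S \<subseteq> verts G' \<and> graph_iso (induced G' S) \<Gamma> \<and> P' S}"
  proof (intro equalityI subsetI)
    fix T assume "T \<in> image \<psi> ` {S. S \<subseteq> verts G \<and> graph_iso (induced G S) \<Gamma> \<and> P S}"
    then obtain S where "S \<subseteq> verts G" "graph_iso (induced G S) \<Gamma>" "P S" "T = \<psi> ` S" by blast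
    then show "T \<in> {S. S \<subseteq> verts G' \<and> graph_iso (induced G' S) \<Gamma> \<and> P' S}"
      using iso P unfolding verts by blast
  next
    fix T assume T: "T \<in> {S. S \<subseteq> verts G' \<and> graph_iso (induced G' S) \<Gamma> \<and> P' S}"
    then obtain S where S: "S \<subseteq> verts G" "T = \<psi> ` S" unfolding verts subset_image_iff by blast
    then show "T \<in> image \<psi> ` {S. S \<subseteq> verts G \<and> graph_iso (induced G S) \<Gamma> \<and> P S}"
      using T iso[OF S(1)] P[OF S(1)] by blast
  qed
qed

lemma perc_graph_verts: "verts (perc_graph X keep r n \<omega>) = (\<lambda>i. X i \<omega>) ` {1..n}"
  by (simp add: perc_graph_def)

lemma doubleton_in_geom_graph:
  "{x, y} \<in> edges (geom_graph Y r) \<longleftrightarrow> x \<in> Y \<and> y \<in> Y \<and> x \<noteq> y \<and> dist x y \<le> r"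
  by (auto simp: geom_graph_def doubleton_eq_iff dist_commute)

text \<open>Where points coincide, an edge may be retained through any pair of indices that represents it.\<close>

lemma doubleton_in_perc_graph:
  assumes "i \<in> {1..n}" "j \<in> {1..n}"
  shows "{X i \<omega>, X j \<omega>} \<in> edges (perc_graph X keep r n \<omega>) \<longleftrightarrow>
    X i \<omega> \<noteq> X j \<omega> \<and> dist (X i \<omega>) (X j \<omega>) \<le> r n \<and>
    (\<exists>i'\<in>{1..n}. \<exists>j'\<in>{1..n}. X i' \<omega> = X i \<omega> \<and> X j' \<omega> = X j \<omega> \<and> keep n {i', j'} \<omega>)" (is "?l \<longleftrightarrow> ?r")
proof
  assume ?l
  then obtain i' j' where ij: "{X i \<omega>, X j \<omega>} = {X i' \<omega>, X j' \<omega>}" "i' \<in> {1..n}" "j' \<in> {1..n}"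
      "{X i' \<omega>, X j' \<omega>} \<in> edges (geom_graph ((\<lambda>i. X i \<omega>) ` {1..n}) (r n))" "keep n {i', j'} \<omega>"
    unfolding perc_graph_def by auto
  have "{X i \<omega>, X j \<omega>} \<in> edges (geom_graph ((\<lambda>i. X i \<omega>) ` {1..n}) (r n))" using ij by simp
  then have "X i \<omega> \<noteq> X j \<omega> \<and> dist (X i \<omega>) (X j \<omega>) \<le> r n"
    unfolding doubleton_in_geom_graph by blast
  moreover have "\<exists>i'\<in>{1..n}. \<exists>j'\<in>{1..n}. X i' \<omega> = X i \<omega> \<and> X j' \<omega> = X j \<omega> \<and> keep n {i', j'} \<omega>"
    using ij(1)[unfolded doubleton_eq_iff] ij(2,3,5) by (metis insert_commute)
  ultimately show ?r by blast
next
  assume r: ?r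
  then obtain i' j' where ij: "i' \<in> {1..n}" "j' \<in> {1..n}" "X i' \<omega> = X i \<omega>" "X j' \<omega> = X j \<omega>" "keep n {i', j'} \<omega>" by blast
  have "{X i' \<omega>, X j' \<omega>} \<in> edges (geom_graph ((\<lambda>i. X i \<omega>) ` {1..n}) (r n))"
    using r assms unfolding doubleton_in_geom_graph ij(3,4) by blast
  moreover have "{X i \<omega>, X j \<omega>} = {X i' \<omega>, X j' \<omega>}" using ij by simp
  ultimately show ?l unfolding perc_graph_def snd_conv using ij(1,2,5) by blast
qed

definition kept_edges :: "'i set \<Rightarrow> ('i \<Rightarrow> 'a::metric_space) \<Rightarrow> real \<Rightarrow> ('i set \<Rightarrow> bool) \<Rightarrow> 'i set set" where
  "kept_edges V x r \<kappa> = {e \<in> proximity_edges V x r. \<kappa> e}"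

lemma induced_count_perc_graph:
  assumes inj: "inj_on (\<lambda>i. X i \<omega>) {1..n}"
  shows "induced_count \<Gamma> A (perc_graph X keep r n \<omega>) =
    card {J. J \<subseteq> {1..n} \<and>
      graph_iso (induced ({1..n}, kept_edges {1..n} (\<lambda>i. X i \<omega>) (r n) (\<lambda>e. keep n e \<omega>)) J) \<Gamma> \<and>
      leftmost_in A ((\<lambda>i. X i \<omega>) ` J)}"
  unfolding induced_count_def
proof (subst card_induced_copies_eq[of "\<lambda>i. X i \<omega>" "({1..n}, kept_edges {1..n} (\<lambda>i. X i \<omega>) (r n) (\<lambda>e. keep n e \<omega>))"
      "perc_graph X keep r n \<omega>" "\<lambda>J. leftmost_in A ((\<lambda>i. X i \<omega>) ` J)" "leftmost_in A", symmetric])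
  fix u v assume "u \<in> verts ({1..n}, kept_edges {1..n} (\<lambda>i. X i \<omega>) (r n) (\<lambda>e. keep n e \<omega>))"
    "v \<in> verts ({1..n}, kept_edges {1..n} (\<lambda>i. X i \<omega>) (r n) (\<lambda>e. keep n e \<omega>))"
  then have uv: "u \<in> {1..n}" "v \<in> {1..n}" by auto
  have eq: "X i \<omega> = X j \<omega> \<longleftrightarrow> i = j" if "i \<in> {1..n}" "j \<in> {1..n}" for i j
    using inj that by (auto dest: inj_onD)
  have "{u, v} \<in> kept_edges {1..n} (\<lambda>i. X i \<omega>) (r n) (\<lambda>e. keep n e \<omega>) \<longleftrightarrow>
      u \<noteq> v \<and> dist (X u \<omega>) (X v \<omega>) \<le> r n \<and> keep n {u, v} \<omega>"
    using uv by (auto simp: kept_edges_def doubleton_in_proximity_edges)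
  also have "\<dots> \<longleftrightarrow> {X u \<omega>, X v \<omega>} \<in> edges (perc_graph X keep r n \<omega>)"
  proof
    assume "u \<noteq> v \<and> dist (X u \<omega>) (X v \<omega>) \<le> r n \<and> keep n {u, v} \<omega>"
    then show "{X u \<omega>, X v \<omega>} \<in> edges (perc_graph X keep r n \<omega>)"
      unfolding doubleton_in_perc_graph[OF uv] using uv eq[OF uv] by blast
  next
    assume "{X u \<omega>, X v \<omega>} \<in> edges (perc_graph X keep r n \<omega>)"
    then obtain i' j' where "X u \<omega> \<noteq> X v \<omega>" "dist (X u \<omega>) (X v \<omega>) \<le> r n" "keep n {i', j'} \<omega>"
        "i' \<in> {1..n}" "j' \<in> {1..n}" "X i' \<omega> = X u \<omega>" "X j' \<omega> = X v \<omega>"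
      unfolding doubleton_in_perc_graph[OF uv] by blast
    moreover from this have "i' = u" "j' = v" using eq[OF _ uv(1)] eq[OF _ uv(2)] by blast+
    ultimately show "u \<noteq> v \<and> dist (X u \<omega>) (X v \<omega>) \<le> r n \<and> keep n {u, v} \<omega>" by auto
  qed
  finally show "{u, v} \<in> edges ({1..n}, kept_edges {1..n} (\<lambda>i. X i \<omega>) (r n) (\<lambda>e. keep n e \<omega>)) \<longleftrightarrow>
      {X u \<omega>, X v \<omega>} \<in> edges (perc_graph X keep r n \<omega>)" by simp
qed (use inj in \<open>auto simp: perc_graph_verts\<close>)

text \<open>Any bijection \<open>b\<close> onto \<open>J\<close> lets one work with a fixed vertex set \<open>V\<close>, independent of \<open>J\<close>.\<close>

lemma induced_kept_edges_iso:
  assumes b: "bij_betw b V J" and "J \<subseteq> W"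
  shows "graph_iso (induced (W, kept_edges W x r \<kappa>) J) \<Gamma> \<longleftrightarrow>
    graph_iso (V, kept_edges V (x \<circ> b) r (\<lambda>e. \<kappa> (b ` e))) \<Gamma>"
proof (rule graph_iso_cong[OF graph_iso_sym])
  have mem: "b i \<in> J" if "i \<in> V" for i using b that by (auto simp: bij_betw_def)
  have eq: "b i = b j \<longleftrightarrow> i = j" if "i \<in> V" "j \<in> V" for i j
    using b that by (auto simp: bij_betw_def dest: inj_onD)
  show "graph_iso (V, kept_edges V (x \<circ> b) r (\<lambda>e. \<kappa> (b ` e))) (induced (W, kept_edges W x r \<kappa>) J)"
    unfolding graph_iso_def
  proof (intro exI[of _ b] conjI ballI)
    show "bij_betw b (verts (V, kept_edges V (x \<circ> b) r (\<lambda>e. \<kappa> (b ` e))))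
        (verts (induced (W, kept_edges W x r \<kappa>) J))"
      using b by (simp add: induced_def)
    fix u v assume "u \<in> verts (V, kept_edges V (x \<circ> b) r (\<lambda>e. \<kappa> (b ` e)))"
      "v \<in> verts (V, kept_edges V (x \<circ> b) r (\<lambda>e. \<kappa> (b ` e)))"
    then have uv: "u \<in> V" "v \<in> V" by auto
    show "{u, v} \<in> edges (V, kept_edges V (x \<circ> b) r (\<lambda>e. \<kappa> (b ` e))) \<longleftrightarrow>
        {b u, b v} \<in> edges (induced (W, kept_edges W x r \<kappa>) J)"
      using uv mem[OF uv(1)] mem[OF uv(2)] subsetD[OF assms(2)]
      by (simp add: induced_def kept_edges_def doubleton_in_proximity_edges eq)
  qed
qed

section \<open>Measurability of the count\<close>

text \<open>A function that depends only on the truth values of finitely many measurable predicates takes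
  finitely many values, each on a finite Boolean combination of measurable sets.\<close>

lemma measurable_finite_pattern:
  assumes "finite I" and meas: "\<And>i. i \<in> I \<Longrightarrow> Measurable.pred M (P i)"
    and det: "\<And>\<omega> \<omega>'. \<omega> \<in> space M \<Longrightarrow> \<omega>' \<in> space M \<Longrightarrow> (\<And>i. i \<in> I \<Longrightarrow> P i \<omega> = P i \<omega>') \<Longrightarrow> g \<omega> = g \<omega>'"
  shows "g \<in> measurable M (count_space UNIV)"
proof -
  define pat where "pat \<omega> = {i \<in> I. P i \<omega>}" for \<omega>
  have pat: "pat \<in> measurable M (count_space (Pow I))"
  proof (subst measurable_count_space_eq2)
    show "finite (Pow I)" using assms(1) by simp
    have "pat -` {s} \<inter> space M \<in> sets M" if "s \<in> Pow I" for s
    proof -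
      have "pat -` {s} \<inter> space M = {\<omega> \<in> space M. \<forall>i\<in>I. P i \<omega> = (i \<in> s)}"
      proof -
        have "pat \<omega> = s \<longleftrightarrow> (\<forall>i\<in>I. P i \<omega> = (i \<in> s))" for \<omega>
          using that unfolding pat_def set_eq_iff mem_Collect_eq Pow_iff subset_iff by meson
        then show ?thesis by (simp add: vimage_def Int_def conj_commute)
      qed
      also have "\<dots> \<in> sets M"
      proof (rule sets.sets_Collect_finite_All[OF _ assms(1)])
        fix i assume "i \<in> I"
        note [measurable] = meas[OF this]
        show "{\<omega> \<in> space M. P i \<omega> = (i \<in> s)} \<in> sets M" by measurable
      qed
      finally show ?thesis .
    qed
    then show "pat \<in> space M \<rightarrow> Pow I \<and> (\<forall>s\<in>Pow I. pat -` {s} \<inter> space M \<in> sets M)"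
      by (auto simp: pat_def)
  qed
  define h where "h s = g (SOME \<omega>. \<omega> \<in> space M \<and> pat \<omega> = s)" for s
  have "h (pat \<omega>) = g \<omega>" if "\<omega> \<in> space M" for \<omega>
  proof -
    have "\<exists>\<omega>'. \<omega>' \<in> space M \<and> pat \<omega>' = pat \<omega>" using that by blast
    then have s: "(SOME \<omega>'. \<omega>' \<in> space M \<and> pat \<omega>' = pat \<omega>) \<in> space M"
      "pat (SOME \<omega>'. \<omega>' \<in> space M \<and> pat \<omega>' = pat \<omega>) = pat \<omega>"
      by (metis (mono_tags, lifting) someI_ex)+
    show ?thesis unfolding h_def
      by (rule det) (use s that in \<open>auto simp: pat_def set_eq_iff\<close>)
  qed
  moreover have "(\<lambda>\<omega>. h (pat \<omega>)) \<in> measurable M (count_space UNIV)"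
    by (rule measurable_compose[OF pat]) simp
  ultimately show ?thesis by (simp cong: measurable_cong)
qed

lemma induced_count_determined:
  fixes X :: "nat \<Rightarrow> 'w \<Rightarrow> real ^ 'd::{finite, linorder}"
  assumes eq: "\<And>i j. i \<in> {1..n} \<Longrightarrow> j \<in> {1..n} \<Longrightarrow> X i \<omega> = X j \<omega> \<longleftrightarrow> X i \<omega>' = X j \<omega>'"
    and near: "\<And>i j. i \<in> {1..n} \<Longrightarrow> j \<in> {1..n} \<Longrightarrow> dist (X i \<omega>) (X j \<omega>) \<le> r n \<longleftrightarrow> dist (X i \<omega>') (X j \<omega>') \<le> r n"
    and keep: "\<And>i j. i \<in> {1..n} \<Longrightarrow> j \<in> {1..n} \<Longrightarrow> i \<noteq> j \<Longrightarrow> keep n {i, j} \<omega> \<longleftrightarrow> keep n {i, j} \<omega>'"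
    and inA: "\<And>i. i \<in> {1..n} \<Longrightarrow> X i \<omega> \<in> A \<longleftrightarrow> X i \<omega>' \<in> A"
    and left: "\<And>i j. i \<in> {1..n} \<Longrightarrow> j \<in> {1..n} \<Longrightarrow>
      first_coord (X i \<omega>) \<le> first_coord (X j \<omega>) \<longleftrightarrow> first_coord (X i \<omega>') \<le> first_coord (X j \<omega>')"
  shows "induced_count \<Gamma> A (perc_graph X keep r n \<omega>) = induced_count \<Gamma> A (perc_graph X keep r n \<omega>')"
proof -
  \<comment> \<open>The map that moves the point of each index from its place under \<open>\<omega>\<close> to its place under \<open>\<omega>'\<close>;
    it is well defined since the same indices coincide in both outcomes.\<close>
  define \<psi> where "\<psi> v = X (SOME i. i \<in> {1..n} \<and> X i \<omega> = v) \<omega>'" for v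
  have \<psi>: "\<psi> (X i \<omega>) = X i \<omega>'" if "i \<in> {1..n}" for i
  proof -
    have "\<exists>j. j \<in> {1..n} \<and> X j \<omega> = X i \<omega>" using that by blast
    then have "(SOME j. j \<in> {1..n} \<and> X j \<omega> = X i \<omega>) \<in> {1..n}"
      "X (SOME j. j \<in> {1..n} \<and> X j \<omega> = X i \<omega>) \<omega> = X i \<omega>"
      by (metis (mono_tags, lifting) someI_ex)+
    then show ?thesis unfolding \<psi>_def using eq that by blast
  qed
  show ?thesis unfolding induced_count_def
  proof (rule card_induced_copies_eq[where \<psi> = \<psi> and P = "leftmost_in A" and P' = "leftmost_in A"])
    show "inj_on \<psi> (verts (perc_graph X keep r n \<omega>))"
      unfolding perc_graph_verts using eq by (auto simp: inj_on_def \<psi>)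
    show "verts (perc_graph X keep r n \<omega>') = \<psi> ` verts (perc_graph X keep r n \<omega>)"
      unfolding perc_graph_verts image_image by (intro image_cong) (auto simp: \<psi>)
  next
    fix u v assume "u \<in> verts (perc_graph X keep r n \<omega>)" "v \<in> verts (perc_graph X keep r n \<omega>)"
    then obtain i j where ij: "i \<in> {1..n}" "j \<in> {1..n}" "u = X i \<omega>" "v = X j \<omega>"
      unfolding perc_graph_verts by blast
    \<comment> \<open>If \<open>i' = j'\<close>, both sides are false because the two points differ.\<close>
    have keep_iff: "X i' \<omega> = X i \<omega> \<and> X j' \<omega> = X j \<omega> \<and> keep n {i', j'} \<omega> \<longleftrightarrow>
        X i' \<omega>' = X i \<omega>' \<and> X j' \<omega>' = X j \<omega>' \<and> keep n {i', j'} \<omega>'"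
      if "i' \<in> {1..n}" "j' \<in> {1..n}" "X i \<omega> \<noteq> X j \<omega>" for i' j'
    proof (cases "i' = j'")
      case True
      then show ?thesis using eq[of i j] eq[of j' i] eq[of j' j] ij(1,2) that by metis
    next
      case False
      then show ?thesis using eq[of i' i] eq[of j' j] keep[of i' j'] ij(1,2) that by blast
    qed
    have kept: "(\<exists>i'\<in>{1..n}. \<exists>j'\<in>{1..n}. X i' \<omega> = X i \<omega> \<and> X j' \<omega> = X j \<omega> \<and> keep n {i', j'} \<omega>) \<longleftrightarrow>
        (\<exists>i'\<in>{1..n}. \<exists>j'\<in>{1..n}. X i' \<omega>' = X i \<omega>' \<and> X j' \<omega>' = X j \<omega>' \<and> keep n {i', j'} \<omega>')"
      if "X i \<omega> \<noteq> X j \<omega>"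
      by (intro bex_cong refl keep_iff that)
    show "{u, v} \<in> edges (perc_graph X keep r n \<omega>) \<longleftrightarrow> {\<psi> u, \<psi> v} \<in> edges (perc_graph X keep r n \<omega>')"
      unfolding ij(3,4) \<psi>[OF ij(1)] \<psi>[OF ij(2)] doubleton_in_perc_graph[OF ij(1,2)]
      using kept eq[OF ij(1,2)] near[OF ij(1,2)] by argo
  next
    fix S assume "S \<subseteq> verts (perc_graph X keep r n \<omega>)"
    then obtain J where J: "J \<subseteq> {1..n}" "S = (\<lambda>i. X i \<omega>) ` J"
      unfolding perc_graph_verts subset_image_iff by blast
    have "\<psi> ` S = (\<lambda>i. X i \<omega>') ` J"
      unfolding J(2) image_image using J(1) by (intro image_cong) (auto simp: \<psi>)
    moreover have "leftmost_in A ((\<lambda>i. X i \<omega>) ` J) \<longleftrightarrow> leftmost_in A ((\<lambda>i. X i \<omega>') ` J)"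
      unfolding leftmost_in_image
    proof (intro bex_cong refl)
      fix i assume "i \<in> J"
      moreover from this have "(\<forall>j\<in>J. first_coord (X i \<omega>) \<le> first_coord (X j \<omega>)) \<longleftrightarrow>
          (\<forall>j\<in>J. first_coord (X i \<omega>') \<le> first_coord (X j \<omega>'))"
        using J(1) by (intro ball_cong refl left) auto
      ultimately show "X i \<omega> \<in> A \<and> (\<forall>j\<in>J. first_coord (X i \<omega>) \<le> first_coord (X j \<omega>)) \<longleftrightarrow>
          X i \<omega>' \<in> A \<and> (\<forall>j\<in>J. first_coord (X i \<omega>') \<le> first_coord (X j \<omega>'))"
        using J(1) inA[of i] by blast
    qed
    ultimately show "leftmost_in A S \<longleftrightarrow> leftmost_in A (\<psi> ` S)"
      unfolding J(2) by simp
  qed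
qed

text \<open>The underlying probability space need not be complete, so measurability has to be shown on the
  whole sample space, including the null set where points coincide. There the count is still determined
  by which points coincide, which are close, which pairs are retained, which points are in \<open>A\<close>, and
  how the first coordinates are ordered.\<close>

lemma measurable_induced_count:
  fixes X :: "nat \<Rightarrow> 'w \<Rightarrow> real ^ 'd::{finite, linorder}"
  assumes X[measurable]: "\<And>i. i \<in> {1..n} \<Longrightarrow> X i \<in> borel_measurable M"
    and keep: "\<And>i j. i \<in> {1..n} \<Longrightarrow> j \<in> {1..n} \<Longrightarrow> i \<noteq> j \<Longrightarrow> Measurable.pred M (keep n {i, j})"
    and [measurable]: "A \<in> sets borel"
  shows "(\<lambda>\<omega>. induced_count \<Gamma> A (perc_graph X keep r n \<omega>)) \<in> measurable M (count_space UNIV)"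
proof -
  define \<P> where "\<P> = (\<lambda>(i, j) \<omega>. X i \<omega> = X j \<omega>) ` ({1..n} \<times> {1..n}) \<union>
    (\<lambda>(i, j) \<omega>. dist (X i \<omega>) (X j \<omega>) \<le> r n) ` ({1..n} \<times> {1..n}) \<union>
    (\<lambda>(i, j). keep n {i, j}) ` {(i, j). i \<in> {1..n} \<and> j \<in> {1..n} \<and> i \<noteq> j} \<union>
    (\<lambda>i \<omega>. X i \<omega> \<in> A) ` {1..n} \<union>
    (\<lambda>(i, j) \<omega>. first_coord (X i \<omega>) \<le> first_coord (X j \<omega>)) ` ({1..n} \<times> {1..n})"
  have fin: "finite {(i, j). i \<in> {1..n} \<and> j \<in> {1..n} \<and> i \<noteq> j}"
    by (rule finite_subset[of _ "{1..n} \<times> {1..n}"]) auto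
  show ?thesis
  proof (rule measurable_finite_pattern[where I = \<P> and P = "\<lambda>P. P"])
    show "finite \<P>" unfolding \<P>_def using fin by simp
    show "Measurable.pred M P" if P: "P \<in> \<P>" for P
    proof -
      consider i j where "P = (\<lambda>\<omega>. X i \<omega> = X j \<omega>)" "i \<in> {1..n}" "j \<in> {1..n}"
        | i j where "P = (\<lambda>\<omega>. dist (X i \<omega>) (X j \<omega>) \<le> r n)" "i \<in> {1..n}" "j \<in> {1..n}"
        | i j where "P = keep n {i, j}" "i \<in> {1..n}" "j \<in> {1..n}" "i \<noteq> j"
        | i where "P = (\<lambda>\<omega>. X i \<omega> \<in> A)" "i \<in> {1..n}"
        | i j where "P = (\<lambda>\<omega>. first_coord (X i \<omega>) \<le> first_coord (X j \<omega>))" "i \<in> {1..n}" "j \<in> {1..n}"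
        using P unfolding \<P>_def by (elim UnE imageE) auto
      then show ?thesis
      proof cases
        case 3 then show ?thesis using keep by simp
      qed (simp_all, measurable)
    qed
  next
    fix \<omega> \<omega>' assume same: "\<And>P. P \<in> \<P> \<Longrightarrow> P \<omega> = P \<omega>'"
    note same' = same[unfolded \<P>_def]
    show "induced_count \<Gamma> A (perc_graph X keep r n \<omega>) = induced_count \<Gamma> A (perc_graph X keep r n \<omega>')"
    proof (rule induced_count_determined)
      fix i j assume ij: "i \<in> {1..n}" "j \<in> {1..n}"
      show "X i \<omega> = X j \<omega> \<longleftrightarrow> X i \<omega>' = X j \<omega>'"
        by (rule same'[of "\<lambda>\<omega>. X i \<omega> = X j \<omega>"]) (use ij in blast)
      show "dist (X i \<omega>) (X j \<omega>) \<le> r n \<longleftrightarrow> dist (X i \<omega>') (X j \<omega>') \<le> r n"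
        by (rule same'[of "\<lambda>\<omega>. dist (X i \<omega>) (X j \<omega>) \<le> r n"]) (use ij in blast)
      show "first_coord (X i \<omega>) \<le> first_coord (X j \<omega>) \<longleftrightarrow> first_coord (X i \<omega>') \<le> first_coord (X j \<omega>')"
        by (rule same'[of "\<lambda>\<omega>. first_coord (X i \<omega>) \<le> first_coord (X j \<omega>)"]) (use ij in blast)
      show "keep n {i, j} \<omega> \<longleftrightarrow> keep n {i, j} \<omega>'" if "i \<noteq> j"
        by (rule same'[of "keep n {i, j}"]) (use ij that in blast)
    next
      fix i assume i: "i \<in> {1..n}"
      show "X i \<omega> \<in> A \<longleftrightarrow> X i \<omega>' \<in> A"
        by (rule same'[of "\<lambda>\<omega>. X i \<omega> \<in> A"]) (use i in blast)
    qed
  qed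
qed

section \<open>Joint law of points and retention marks\<close>

lemma (in prob_space) prob_Inter_reindexed:
  assumes indep: "indep_sets F K" and c: "inj_on c J" "c ` J \<subseteq> K" and J: "finite J" "J \<noteq> {}"
    and ev: "\<And>j. j \<in> J \<Longrightarrow> A j \<in> F (c j)"
  shows "prob (\<Inter>j\<in>J. A j) = (\<Prod>j\<in>J. prob (A j))"
proof -
  define A' where "A' i = A (inv_into J c i)" for i
  have A': "A' (c j) = A j" if "j \<in> J" for j
    unfolding A'_def using c(1) that by (simp add: inv_into_f_f)
  have "prob (\<Inter>i\<in>c ` J. A' i) = (\<Prod>i\<in>c ` J. prob (A' i))"
    by (rule indep_setsD[OF indep c(2)]) (use J ev A' in auto)
  then show ?thesis by (simp add: prod.reindex[OF c(1)] A')
qed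

context percolated_points
begin

lemma measurable_point: "i \<ge> 1 \<Longrightarrow> X i \<in> borel_measurable M"
  using points_distributed[of i] by (auto dest: distributed_measurable)

lemma prob_point_in:
  assumes "i \<ge> 1" "B \<in> sets borel"
  shows "ennreal (prob (X i -` B \<inter> space M)) = emeasure (density lborel (\<lambda>x. ennreal (f x))) B"
proof -
  have "emeasure (distr M lborel (X i)) B = emeasure M (X i -` B \<inter> space M)"
    using measurable_point[OF assms(1)] assms(2) by (intro emeasure_distr) auto
  then show ?thesis
    using distributed_distr_eq_density[OF points_distributed[OF assms(1)]] by (simp add: emeasure_eq_measure)
qed

lemma prob_space_density: "prob_space (density lborel (\<lambda>x. ennreal (f x)))"
  using distributed_distr_eq_density[OF points_distributed[of 1]] measurable_point[of 1]
  by (metis distributed_measurable order_refl points_distributed prob_space_distr)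

lemma integrable_density: "integrable lborel f"
proof -
  interpret D: prob_space "density lborel (\<lambda>x. ennreal (f x))" by (rule prob_space_density)
  have [measurable]: "f \<in> borel_measurable borel" by (rule density_measurable)
  have "emeasure (density lborel (\<lambda>x. ennreal (f x))) UNIV = 1"
    using D.emeasure_space_1 by simp
  then have "(\<integral>\<^sup>+x. ennreal (f x) \<partial>lborel) = 1"
    by (simp add: emeasure_density)
  then show ?thesis
    by (intro integrableI_nonneg) (auto simp: density_nonneg)
qed

lemma PiM_density:
  fixes V :: "'i set"
  assumes "finite V"
  shows "PiM V (\<lambda>_. density lborel (\<lambda>x. ennreal (f x))) =
    density (PiM V (\<lambda>_. lborel)) (\<lambda>x. \<Prod>i\<in>V. ennreal (f (x i)))"
proof -
  have [measurable]: "f \<in> borel_measurable borel" by (rule density_measurable)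
  interpret D: prob_space "density lborel (\<lambda>x. ennreal (f x))" by (rule prob_space_density)
  interpret D: product_sigma_finite "\<lambda>_::'i. density lborel (\<lambda>x. ennreal (f x))"
    by standard
  show ?thesis
  proof (rule sym, rule D.PiM_eqI[OF assms])
    show "sets (density (PiM V (\<lambda>_. lborel)) (\<lambda>x. \<Prod>i\<in>V. ennreal (f (x i)))) =
        sets (PiM V (\<lambda>_. density lborel (\<lambda>x. ennreal (f x))))"
      by (simp cong: sets_PiM_cong)
    fix A :: "'i \<Rightarrow> (real ^ 'd) set" assume "\<And>i. i \<in> V \<Longrightarrow> A i \<in> sets (density lborel (\<lambda>x. ennreal (f x)))"
    then have A[measurable]: "\<And>i. i \<in> V \<Longrightarrow> A i \<in> sets borel" by simp
    have AE: "(\<Pi>\<^sub>E i\<in>V. A i) \<in> sets (PiM V (\<lambda>_. lborel))"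
      using assms A by (intro sets_PiM_I_finite) auto
    have "emeasure (density (PiM V (\<lambda>_. lborel)) (\<lambda>x. \<Prod>i\<in>V. ennreal (f (x i)))) (\<Pi>\<^sub>E i\<in>V. A i) =
        (\<integral>\<^sup>+x. (\<Prod>i\<in>V. ennreal (f (x i))) * indicator (\<Pi>\<^sub>E i\<in>V. A i) x \<partial>PiM V (\<lambda>_. lborel))"
      by (rule emeasure_density[OF _ AE]) measurable
    also have "\<dots> = (\<integral>\<^sup>+x. (\<Prod>i\<in>V. ennreal (f (x i)) * indicator (A i) (x i)) \<partial>PiM V (\<lambda>_. lborel))"
    proof (rule nn_integral_cong)
      fix x :: "'i \<Rightarrow> real ^ 'd" assume "x \<in> space (PiM V (\<lambda>_. lborel))"
      then have "indicator (\<Pi>\<^sub>E i\<in>V. A i) x = (\<Prod>i\<in>V. indicator (A i) (x i) :: ennreal)"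
        using assms by (auto simp: space_PiM PiE_iff indicator_def prod_zero_iff intro!: prod.neutral)
      then show "(\<Prod>i\<in>V. ennreal (f (x i))) * indicator (\<Pi>\<^sub>E i\<in>V. A i) x =
          (\<Prod>i\<in>V. ennreal (f (x i)) * indicator (A i) (x i))"
        by (simp add: prod.distrib)
    qed
    also have "\<dots> = (\<Prod>i\<in>V. \<integral>\<^sup>+x. ennreal (f x) * indicator (A i) x \<partial>lborel)"
      using assms A by (intro lborel_product.product_nn_integral_prod) auto
    also have "\<dots> = (\<Prod>i\<in>V. emeasure (density lborel (\<lambda>x. ennreal (f x))) (A i))"
      by (intro prod.cong refl emeasure_density[symmetric]) auto
    finally show "emeasure (density (PiM V (\<lambda>_. lborel)) (\<lambda>x. \<Prod>i\<in>V. ennreal (f (x i)))) (\<Pi>\<^sub>E i\<in>V. A i) =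
        (\<Prod>i\<in>V. emeasure (density lborel (\<lambda>x. ennreal (f x))) (A i))" .
  qed
qed

lemma mark_event_prob:
  assumes "n \<ge> 1" "e \<subseteq> {1..n}" "card e = 2"
  shows "prob {\<omega> \<in> space M. keep n e \<omega> = B} = (if B then p n else 1 - p n)"
proof (cases B)
  case False
  have "{\<omega> \<in> space M. keep n e \<omega>} \<in> events"
    using marks_measurable[OF assms] by simp
  then have "prob {\<omega> \<in> space M. \<not> keep n e \<omega>} = 1 - prob {\<omega> \<in> space M. keep n e \<omega>}"
    by (subst prob_compl[symmetric]) (auto intro!: arg_cong[where f = prob])
  then show ?thesis using False marks_prob[OF assms] by simp
qed (use marks_prob[OF assms] in simp)

text \<open>On rectangles the joint independence of points and marks is used directly: the disjoint sum
  \<open>V <+> G\<close> indexes one event per point and one per edge.\<close>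

lemma prob_rectangle_marks:
  fixes b :: "'i \<Rightarrow> nat"
  assumes n: "n \<ge> 1" and V: "finite V" "V \<noteq> {}" and b: "inj_on b V" "b ` V \<subseteq> {1..n}"
    and G: "finite G" "\<And>e. e \<in> G \<Longrightarrow> e \<subseteq> V \<and> card e = 2" and H: "H \<subseteq> G"
    and B: "\<And>i. i \<in> V \<Longrightarrow> B i \<in> sets borel"
  shows "prob {\<omega> \<in> space M. (\<forall>i\<in>V. X (b i) \<omega> \<in> B i) \<and> (\<forall>e\<in>G. keep n (b ` e) \<omega> = (e \<in> H))} =
    p n ^ card H * (1 - p n) ^ (card G - card H) * (\<Prod>i\<in>V. prob (X (b i) -` B i \<inter> space M))"
proof -
  let ?F = "\<lambda>s. case s of Inl i \<Rightarrow> sets (vimage_algebra (space M) (X i) borel)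
              | Inr e \<Rightarrow> sets (vimage_algebra (space M) (keep n e) (count_space UNIV))"
  define c where "c j = (case j of Inl i \<Rightarrow> Inl (b i) | Inr e \<Rightarrow> Inr (b ` e))" for j
  define A where "A j = (case j of Inl i \<Rightarrow> X (b i) -` B i \<inter> space M
      | Inr e \<Rightarrow> {\<omega> \<in> space M. keep n (b ` e) \<omega> = (e \<in> H)})" for j
  have be: "b ` e \<subseteq> {1..n}" "card (b ` e) = 2" if "e \<in> G" for e
  proof -
    show "b ` e \<subseteq> {1..n}" using b(2) G(2)[OF that] by auto
    have "inj_on b e" using b(1) G(2)[OF that] by (auto intro: inj_on_subset)
    then show "card (b ` e) = 2" using G(2)[OF that] by (simp add: card_image)
  qed
  have bG: "inj_on (image b) G"
    using inj_on_image_Pow[OF b(1)] by (rule inj_on_subset) (use G(2) in blast)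
  have c: "inj_on c (V <+> G)"
  proof (rule inj_onI)
    fix j j' assume "j \<in> V <+> G" "j' \<in> V <+> G" "c j = c j'"
    then show "j = j'"
      by (elim PlusE) (simp_all add: c_def inj_on_eq_iff[OF b(1)] inj_on_eq_iff[OF bG])
  qed
  have cK: "c ` (V <+> G) \<subseteq> Inl ` {1..} \<union> Inr ` {e. e \<subseteq> {1..n} \<and> card e = 2}"
    using be b(2) by (fastforce simp: c_def)
  have ev: "A j \<in> ?F (c j)" if "j \<in> V <+> G" for j
    using that
  proof (elim PlusE)
    fix i assume i: "i \<in> V" "j = Inl i"
    then show ?thesis using B[OF i(1)] by (auto simp: A_def c_def intro!: in_vimage_algebra)
  next
    fix e assume e: "e \<in> G" "j = Inr e"
    have "A j = keep n (b ` e) -` {e \<in> H} \<inter> space M" using e by (auto simp: A_def)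
    then show ?thesis using e by (auto simp: c_def intro!: in_vimage_algebra)
  qed
  have "prob (\<Inter>j\<in>V <+> G. A j) = (\<Prod>j\<in>V <+> G. prob (A j))"
    by (rule prob_Inter_reindexed[OF indep[OF n] c cK _ _ ev]) (use V G in auto)
  also have "\<dots> = (\<Prod>i\<in>V. prob (X (b i) -` B i \<inter> space M)) * (\<Prod>e\<in>G. if e \<in> H then p n else 1 - p n)"
    using V G be by (subst prod.Plus) (auto simp: A_def mark_event_prob[OF n] intro!: prod.cong)
  also have "(\<Prod>e\<in>G. if e \<in> H then p n else 1 - p n) = p n ^ card H * (1 - p n) ^ card (G - H)"
    using G(1) H by (subst prod.If_cases) (auto simp: Int_absorb1 Diff_eq)
  also have "card (G - H) = card G - card H"
    using G(1) H by (meson card_Diff_subset finite_subset)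
  also have "(\<Inter>j\<in>V <+> G. A j) =
      {\<omega> \<in> space M. (\<forall>i\<in>V. X (b i) \<omega> \<in> B i) \<and> (\<forall>e\<in>G. keep n (b ` e) \<omega> = (e \<in> H))}"
    using V(2) by (auto simp: A_def Plus_def ball_Un)
  finally show ?thesis by (simp add: mult_ac)
qed

text \<open>Both sides are finite measures in \<open>S\<close> that agree on rectangles; on the left this is the law of the
  points on the event that the marks on \<open>G\<close> single out \<open>H\<close>.\<close>

lemma prob_points_marks:
  fixes b :: "'i \<Rightarrow> nat"
  assumes n: "n \<ge> 1" and V: "finite V" "V \<noteq> {}" and b: "inj_on b V" "b ` V \<subseteq> {1..n}"
    and G: "finite G" "\<And>e. e \<in> G \<Longrightarrow> e \<subseteq> V \<and> card e = 2" and H: "H \<subseteq> G"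
    and S: "S \<in> sets (PiM V (\<lambda>_. lborel))"
  defines "D \<equiv> {\<omega> \<in> space M. (\<lambda>i\<in>V. X (b i) \<omega>) \<in> S \<and> (\<forall>e\<in>G. keep n (b ` e) \<omega> = (e \<in> H))}"
  shows "D \<in> events" "prob D = p n ^ card H * (1 - p n) ^ (card G - card H) *
      (\<integral>x. (\<Prod>i\<in>V. f (x i)) * indicator S x \<partial>PiM V (\<lambda>_. lborel))"
proof -
  define q where "q = p n ^ card H * (1 - p n) ^ (card G - card H)"
  have q: "0 \<le> q" using prob_range[OF n] by (simp add: q_def)
  have Xm[measurable]: "X (b i) \<in> borel_measurable M" if "i \<in> V" for i
    using b(2) that by (intro measurable_point) auto
  define Y where "Y \<omega> = (\<lambda>i\<in>V. X (b i) \<omega>)" for \<omega>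
  have Y[measurable]: "Y \<in> measurable M (PiM V (\<lambda>_. lborel))"
    unfolding Y_def by (rule measurable_restrict) (use Xm in simp)
  define C where "C = {\<omega> \<in> space M. \<forall>e\<in>G. keep n (b ` e) \<omega> = (e \<in> H)}"
  have C[measurable]: "C \<in> events"
    unfolding C_def
  proof (rule sets.sets_Collect_finite_All[OF _ G(1)])
    fix e assume e: "e \<in> G"
    have "inj_on b e" using b(1) G(2)[OF e] by (auto intro: inj_on_subset)
    then have "Measurable.pred M (keep n (b ` e))"
      using b(2) G(2)[OF e] by (intro marks_measurable[OF n]) (auto simp: card_image)
    then show "{\<omega> \<in> space M. keep n (b ` e) \<omega> = (e \<in> H)} \<in> events" by measurable
  qed
  have D: "D = Y -` S \<inter> C" by (auto simp: D_def C_def Y_def)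
  have "Y -` S \<inter> C = (Y -` S \<inter> space M) \<inter> C" by (auto simp: C_def)
  with measurable_sets[OF Y S] C show Dev: "D \<in> events" unfolding D by auto
  \<comment> \<open>The law of the points restricted to the event \<open>C\<close> about the marks, and the product law scaled
    by the probability \<open>q\<close> of that event.\<close>
  let ?P = "distr (density M (indicator C)) (PiM V (\<lambda>_. lborel)) Y"
  let ?Q = "density (PiM V (\<lambda>_. density lborel (\<lambda>x. ennreal (f x)))) (\<lambda>_. ennreal q)"
  have [measurable]: "f \<in> borel_measurable borel" by (rule density_measurable)
  interpret D: prob_space "density lborel (\<lambda>x. ennreal (f x))" by (rule prob_space_density)
  interpret D: product_sigma_finite "\<lambda>_::'i. density lborel (\<lambda>x. ennreal (f x))"
    by standard
  have P: "emeasure ?P T = prob (Y -` T \<inter> C)" if "T \<in> sets (PiM V (\<lambda>_. lborel))" for T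
  proof -
    have "emeasure ?P T = emeasure (density M (indicator C)) (Y -` T \<inter> space M)"
      using that by (subst emeasure_distr) auto
    also have "\<dots> = (\<integral>\<^sup>+\<omega>. indicator C \<omega> * indicator (Y -` T \<inter> space M) \<omega> \<partial>M)"
      using measurable_sets[OF Y that] by (intro emeasure_density) auto
    also have "\<dots> = (\<integral>\<^sup>+\<omega>. indicator (Y -` T \<inter> C) \<omega> \<partial>M)"
      by (intro nn_integral_cong) (auto simp: indicator_def C_def)
    also have "\<dots> = prob (Y -` T \<inter> C)"
    proof -
      have "Y -` T \<inter> C = (Y -` T \<inter> space M) \<inter> C" by (auto simp: C_def)
      then have "Y -` T \<inter> C \<in> events" using measurable_sets[OF Y that] C by auto
      then show ?thesis by (simp add: emeasure_eq_measure)
    qed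
    finally show ?thesis .
  qed
  have sP: "sets (PiM V (\<lambda>_. lborel :: (real ^ 'd) measure)) = sets (PiM V (\<lambda>_. density lborel (\<lambda>x. ennreal (f x))))"
    by (intro sets_PiM_cong) auto
  have "?P = ?Q"
  proof (rule measure_eqI_PiM_finite[OF V(1)])
    show "sets ?P = sets (PiM V (\<lambda>_. density lborel (\<lambda>x. ennreal (f x))))" using sP by simp
    show "sets ?Q = sets (PiM V (\<lambda>_. density lborel (\<lambda>x. ennreal (f x))))" by simp
    show "range (\<lambda>_::nat. space (PiM V (\<lambda>_. density lborel (\<lambda>x. ennreal (f x))))) \<subseteq>
        prod_algebra V (\<lambda>_. density lborel (\<lambda>x. ennreal (f x)))"
      unfolding space_PiM using V(1) by (intro image_subsetI prod_algebraI_finite) auto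
    show "(\<Union>i::nat. space (PiM V (\<lambda>_. density lborel (\<lambda>x. ennreal (f x))))) =
        space (PiM V (\<lambda>_. density lborel (\<lambda>x. ennreal (f x))))" by simp
    show "emeasure ?P (space (PiM V (\<lambda>_. density lborel (\<lambda>x. ennreal (f x))))) \<noteq> \<infinity>" for i :: nat
      by (subst P) (auto simp: sP)
  next
    fix B :: "'i \<Rightarrow> (real ^ 'd) set" assume "\<And>i. i \<in> V \<Longrightarrow> B i \<in> sets (density lborel (\<lambda>x. ennreal (f x)))"
    then have B: "\<And>i. i \<in> V \<Longrightarrow> B i \<in> sets borel" by simp
    have BE: "(\<Pi>\<^sub>E i\<in>V. B i) \<in> sets (PiM V (\<lambda>_. lborel))"
      using V(1) B by (intro sets_PiM_I_finite) auto
    have "Y -` (\<Pi>\<^sub>E i\<in>V. B i) \<inter> C =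
        {\<omega> \<in> space M. (\<forall>i\<in>V. X (b i) \<omega> \<in> B i) \<and> (\<forall>e\<in>G. keep n (b ` e) \<omega> = (e \<in> H))}"
      by (auto simp: Y_def C_def PiE_iff)
    then have "emeasure ?P (\<Pi>\<^sub>E i\<in>V. B i) = ennreal (q * (\<Prod>i\<in>V. prob (X (b i) -` B i \<inter> space M)))"
      unfolding P[OF BE] using prob_rectangle_marks[OF n V b G H B] by (simp add: q_def)
    also have "\<dots> = ennreal q * (\<Prod>i\<in>V. emeasure (density lborel (\<lambda>x. ennreal (f x))) (B i))"
    proof -
      have "(\<Prod>i\<in>V. emeasure (density lborel (\<lambda>x. ennreal (f x))) (B i)) =
          (\<Prod>i\<in>V. ennreal (prob (X (b i) -` B i \<inter> space M)))"
        by (intro prod.cong refl prob_point_in[symmetric] B) (use b(2) in auto)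
      then show ?thesis using q by (simp add: ennreal_mult prod_nonneg prod_ennreal)
    qed
    also have "\<dots> = ennreal q * emeasure (PiM V (\<lambda>_. density lborel (\<lambda>x. ennreal (f x)))) (\<Pi>\<^sub>E i\<in>V. B i)"
      using V(1) B by (subst D.emeasure_PiM) auto
    also have "\<dots> = emeasure ?Q (\<Pi>\<^sub>E i\<in>V. B i)"
      using BE sP by (subst emeasure_density_const) auto
    finally show "emeasure ?P (\<Pi>\<^sub>E i\<in>V. B i) = emeasure ?Q (\<Pi>\<^sub>E i\<in>V. B i)" .
  qed
  then have "ennreal (prob D) = ennreal q * emeasure (PiM V (\<lambda>_. density lborel (\<lambda>x. ennreal (f x)))) S"
    unfolding D P[OF S, symmetric] using S sP by (simp add: emeasure_density_const)
  also have "emeasure (PiM V (\<lambda>_. density lborel (\<lambda>x. ennreal (f x)))) S =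
      (\<integral>\<^sup>+x. ennreal ((\<Prod>i\<in>V. f (x i)) * indicator S x) \<partial>PiM V (\<lambda>_. lborel))"
    unfolding PiM_density[OF V(1)] using S
    by (subst emeasure_density)
      (auto simp: density_nonneg prod_ennreal prod_nonneg ennreal_mult ennreal_indicator intro!: nn_integral_cong)
  finally have "enn2real (ennreal (prob D)) =
      enn2real (ennreal q * (\<integral>\<^sup>+x. ennreal ((\<Prod>i\<in>V. f (x i)) * indicator S x) \<partial>PiM V (\<lambda>_. lborel)))"
    by (rule arg_cong)
  then have "prob D = q * enn2real (\<integral>\<^sup>+x. ennreal ((\<Prod>i\<in>V. f (x i)) * indicator S x) \<partial>PiM V (\<lambda>_. lborel))"
    using q by (simp only: enn2real_mult enn2real_ennreal measure_nonneg)
  moreover have "enn2real (\<integral>\<^sup>+x. ennreal ((\<Prod>i\<in>V. f (x i)) * indicator S x) \<partial>PiM V (\<lambda>_. lborel)) =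
      (\<integral>x. (\<Prod>i\<in>V. f (x i)) * indicator S x \<partial>PiM V (\<lambda>_. lborel))"
    using S by (intro integral_eq_nn_integral[symmetric]) (auto simp: density_nonneg prod_nonneg)
  ultimately show "prob D = p n ^ card H * (1 - p n) ^ (card G - card H) *
      (\<integral>x. (\<Prod>i\<in>V. f (x i)) * indicator S x \<partial>PiM V (\<lambda>_. lborel))"
    unfolding q_def by simp
qed

text \<open>The law of two points has a density, and the diagonal is a null set since its sections are
  singletons.\<close>

lemma AE_points_distinct: "AE \<omega> in M. inj_on (\<lambda>i. X i \<omega>) {1..n}"
proof -
  have "AE \<omega> in M. X i \<omega> \<noteq> X j \<omega>" if ij: "i \<in> {1..n}" "j \<in> {1..n}" "i \<noteq> j" for i j
  proof -
    let ?L = "PiM {i, j} (\<lambda>_. lborel :: (real ^ 'd) measure)"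
    define S where "S = {x \<in> space ?L. x i = x j}"
    have [measurable]: "(\<lambda>x. x i) \<in> borel_measurable ?L" "(\<lambda>x. x j) \<in> borel_measurable ?L"
      using measurable_component_singleton[of _ "{i, j}" "\<lambda>_. lborel :: (real ^ 'd) measure"] by auto
    have S[measurable]: "S \<in> sets ?L" unfolding S_def by measurable
    have "emeasure ?L S = (\<integral>\<^sup>+x. indicator S x \<partial>PiM (insert j {i}) (\<lambda>_. lborel))"
      using S by (simp add: insert_commute)
    also have "\<dots> = (\<integral>\<^sup>+x. \<integral>\<^sup>+y. indicator S (x(j := y)) \<partial>lborel \<partial>PiM {i} (\<lambda>_. lborel))"
      using ij S by (intro lborel_product.product_nn_integral_insert) (auto simp: insert_commute)
    also have "\<dots> = (\<integral>\<^sup>+x. 0 \<partial>PiM {i} (\<lambda>_. lborel :: (real ^ 'd) measure))"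
    proof (rule nn_integral_cong)
      fix x :: "nat \<Rightarrow> real ^ 'd" assume "x \<in> space (PiM {i} (\<lambda>_. lborel))"
      have "(\<integral>\<^sup>+y. indicator S (x(j := y)) \<partial>lborel) \<le> (\<integral>\<^sup>+y. indicator {x i} y \<partial>lborel)"
        by (intro nn_integral_mono) (use ij in \<open>auto simp: S_def indicator_def\<close>)
      then show "(\<integral>\<^sup>+y. indicator S (x(j := y)) \<partial>lborel) = 0" by simp
    qed
    finally have "emeasure ?L S = 0" by simp
    then have "AE x in ?L. x \<notin> S" using S by (intro AE_not_in) (auto simp: null_sets_def)
    then have "(\<integral>x. (\<Prod>i\<in>{i, j}. f (x i)) * indicator S x \<partial>?L) = 0"
      by (intro integral_eq_zero_AE) (auto elim!: eventually_mono)
    moreover have "n \<ge> 1" using ij by auto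
    ultimately have "prob {\<omega> \<in> space M. (\<lambda>k\<in>{i, j}. X (id k) \<omega>) \<in> S \<and> (\<forall>e\<in>{}. keep n (id ` e) \<omega> = (e \<in> {}))} = 0"
      "{\<omega> \<in> space M. (\<lambda>k\<in>{i, j}. X (id k) \<omega>) \<in> S \<and> (\<forall>e\<in>{}. keep n (id ` e) \<omega> = (e \<in> {}))} \<in> events"
      using prob_points_marks[of n "{i, j}" id "{}" "{}" S] ij S by auto
    moreover have "{\<omega> \<in> space M. (\<lambda>k\<in>{i, j}. X (id k) \<omega>) \<in> S \<and> (\<forall>e\<in>{}. keep n (id ` e) \<omega> = (e \<in> {}))}
        = {\<omega> \<in> space M. X i \<omega> = X j \<omega>}"
      by (auto simp: S_def space_PiM)
    ultimately have "{\<omega> \<in> space M. X i \<omega> = X j \<omega>} \<in> null_sets M"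
      by (simp add: null_sets_def emeasure_eq_measure)
    then show ?thesis by (intro AE_I'[of "{\<omega> \<in> space M. X i \<omega> = X j \<omega>}"]) auto
  qed
  then have "AE \<omega> in M. \<forall>i\<in>{1..n}. \<forall>j\<in>{1..n}. i \<noteq> j \<longrightarrow> X i \<omega> \<noteq> X j \<omega>"
    by (intro AE_ball_countable') auto
  then show ?thesis by eventually_elim (auto simp: inj_on_def)
qed

end

section \<open>The expected number of induced copies\<close>

definition pairs :: "'i set \<Rightarrow> 'i set set" where
  "pairs V = {e. e \<subseteq> V \<and> card e = 2}"

text \<open>The graphs that percolation can produce from \<open>G\<close> and that count as an induced copy of \<open>\<Gamma>\<close>.\<close>

definition copies :: "'v sgraph \<Rightarrow> 'i set \<Rightarrow> 'i set set \<Rightarrow> 'i set set set" where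
  "copies \<Gamma> V G = {H. H \<subseteq> G \<and> graph_iso (V, H) \<Gamma>}"

lemma finite_pairs: "finite V \<Longrightarrow> finite (pairs V)"
  unfolding pairs_def by (rule finite_subset[of _ "Pow V"]) auto

lemma card_pairs: "finite V \<Longrightarrow> card (pairs V) = card V choose 2"
  unfolding pairs_def by (rule n_subsets)

lemma proximity_edges_subset_pairs: "proximity_edges V x r \<subseteq> pairs V"
  unfolding pairs_def using proximity_edges_pairs by blast

lemma finite_copies: "finite V \<Longrightarrow> G \<subseteq> pairs V \<Longrightarrow> finite (copies \<Gamma> V G)"
  unfolding copies_def
  by (rule finite_subset[of _ "Pow G"]) (auto intro: finite_subset[OF _ finite_pairs])

lemma card_copy:
  assumes "finite V" "G \<subseteq> pairs V" "simple_graph \<Gamma>" "H \<in> copies \<Gamma> V G"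
  shows "card H = card (edges \<Gamma>)"
proof -
  have "simple_graph (V, H)"
    using assms by (auto simp: copies_def simple_graph_def pairs_def)
  then show ?thesis
    using graph_iso_card_edges[of "(V, H)" \<Gamma>] assms(3,4) by (simp add: copies_def)
qed

text \<open>The event is split according to the geometric graph \<open>G\<close> and the graph \<open>H\<close> that percolation leaves.
  Every admissible \<open>H\<close> has as many edges as \<open>\<Gamma>\<close>, so its probability does not depend on \<open>H\<close>, and only
  the number of admissible \<open>H\<close> remains.\<close>

lemma prob_labelled_copy:
  fixes f :: "real ^ 'd::{finite, linorder} \<Rightarrow> real" and b :: "'i \<Rightarrow> nat" and r :: real
  assumes "percolated_points M f X p keep"
    and n: "n \<ge> 1" and V: "finite V" "V \<noteq> {}" and b: "inj_on b V" "b ` V \<subseteq> {1..n}"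
    and \<Gamma>: "simple_graph \<Gamma>" and A: "A \<in> sets borel"
  defines "D \<equiv> {\<omega> \<in> space M. leftmost_in A ((\<lambda>i. X (b i) \<omega>) ` V) \<and>
      graph_iso (V, kept_edges V (\<lambda>i. X (b i) \<omega>) r (\<lambda>e. keep n (b ` e) \<omega>)) \<Gamma>}"
  shows "D \<in> sets M"
    "measure M D = p n ^ card (edges \<Gamma>) * (\<Sum>G\<in>Pow (pairs V). real (card (copies \<Gamma> V G)) *
      (1 - p n) ^ (card G - card (edges \<Gamma>)) * config_integral f A V G r)"
proof -
  interpret percolated_points M f X p keep by fact
  define S where "S G = {x \<in> space (PiM V (\<lambda>_. lborel :: (real ^ 'd::{finite, linorder}) measure)).
      proximity_edges V x r = G \<and> leftmost_in A (x ` V)}" for G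
  define D' where "D' = (\<lambda>(G, H). {\<omega> \<in> space M. (\<lambda>i\<in>V. X (b i) \<omega>) \<in> S G \<and> (\<forall>e\<in>G. keep n (b ` e) \<omega> = (e \<in> H))})"
  define I where "I = Sigma (Pow (pairs V)) (copies \<Gamma> V)"
  have finG: "finite G" if "G \<in> Pow (pairs V)" for G
    using that finite_pairs[OF V(1)] by (auto intro: finite_subset)
  have fin: "finite I"
    unfolding I_def using finite_pairs[OF V(1)] by (intro finite_SigmaI finite_copies[OF V(1)]) auto
  have S: "S G \<in> sets (PiM V (\<lambda>_. lborel))" for G
  proof -
    have comp: "(\<lambda>x. x i) \<in> borel_measurable (PiM V (\<lambda>_. lborel :: (real ^ 'd::{finite, linorder}) measure))"
      if "i \<in> V" for i
      using measurable_component_singleton[OF that, of "\<lambda>_. lborel :: (real ^ 'd::{finite, linorder}) measure"] by simp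
    have "Measurable.pred (PiM V (\<lambda>_. lborel :: (real ^ 'd::{finite, linorder}) measure)) (\<lambda>x. proximity_edges V x r = G)"
      by (rule measurable_proximity_edges_eq[OF V(1), of "\<lambda>i x. x i", OF comp])
    moreover have "Measurable.pred (PiM V (\<lambda>_. lborel :: (real ^ 'd::{finite, linorder}) measure)) (\<lambda>x. leftmost_in A (x ` V))"
      by (rule measurable_leftmost_in_image[OF V(1), of "\<lambda>i x. x i", OF comp A])
    ultimately show ?thesis
      unfolding S_def by (intro sets.sets_Collect_conj) (simp_all add: pred_def)
  qed
  have D': "D' (G, H) \<in> events"
    "prob (D' (G, H)) = p n ^ card H * (1 - p n) ^ (card G - card H) * config_integral f A V G r"
    if "(G, H) \<in> I" for G H
  proof -
    have G: "finite G" "\<And>e. e \<in> G \<Longrightarrow> e \<subseteq> V \<and> card e = 2" and H: "H \<subseteq> G"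
      using that finG by (auto simp: I_def pairs_def copies_def)
    show "D' (G, H) \<in> events"
      using prob_points_marks(1)[OF n V b G H S] by (simp add: D'_def)
    have "(\<integral>x. (\<Prod>i\<in>V. f (x i)) * indicator (S G) x \<partial>PiM V (\<lambda>_. lborel)) = config_integral f A V G r"
      unfolding config_integral_def S_def
      by (intro Bochner_Integration.integral_cong refl) (auto simp: indicator_def)
    then show "prob (D' (G, H)) = p n ^ card H * (1 - p n) ^ (card G - card H) * config_integral f A V G r"
      using prob_points_marks(2)[OF n V b G H S] by (simp add: D'_def)
  qed
  have mem: "\<omega> \<in> D' (G, H) \<longleftrightarrow> \<omega> \<in> space M \<and> proximity_edges V (\<lambda>i. X (b i) \<omega>) r = G \<and>
      leftmost_in A ((\<lambda>i. X (b i) \<omega>) ` V) \<and> kept_edges V (\<lambda>i. X (b i) \<omega>) r (\<lambda>e. keep n (b ` e) \<omega>) = H"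
    if "(G, H) \<in> I" for \<omega> G H
  proof -
    have "proximity_edges V (\<lambda>i\<in>V. X (b i) \<omega>) r = proximity_edges V (\<lambda>i. X (b i) \<omega>) r"
      by (rule proximity_edges_cong) simp
    moreover have "(\<lambda>i\<in>V. X (b i) \<omega>) ` V = (\<lambda>i. X (b i) \<omega>) ` V" by (intro image_cong) auto
    moreover have "H \<subseteq> G" using that by (simp add: I_def copies_def)
    ultimately show ?thesis
      by (auto simp: D'_def S_def space_PiM kept_edges_def)
  qed
  have D_eq: "D = (\<Union>j\<in>I. D' j)"
  proof (intro equalityI subsetI)
    fix \<omega> assume "\<omega> \<in> D"
    let ?G = "proximity_edges V (\<lambda>i. X (b i) \<omega>) r"
    let ?H = "kept_edges V (\<lambda>i. X (b i) \<omega>) r (\<lambda>e. keep n (b ` e) \<omega>)"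
    have "(?G, ?H) \<in> I"
      using \<open>\<omega> \<in> D\<close> proximity_edges_subset_pairs[of V "\<lambda>i. X (b i) \<omega>" r]
      by (auto simp: I_def copies_def D_def kept_edges_def)
    moreover from this have "\<omega> \<in> D' (?G, ?H)" using \<open>\<omega> \<in> D\<close> by (simp add: mem D_def)
    ultimately show "\<omega> \<in> (\<Union>j\<in>I. D' j)" by blast
  next
    fix \<omega> assume "\<omega> \<in> (\<Union>j\<in>I. D' j)"
    then obtain G H where "(G, H) \<in> I" "\<omega> \<in> D' (G, H)" by auto
    then show "\<omega> \<in> D" by (auto simp: mem D_def) (auto simp: I_def copies_def)
  qed
  show "D \<in> events" unfolding D_eq using fin D'(1) by (intro sets.finite_UN) auto
  have "disjoint_family_on D' I"
    unfolding disjoint_family_on_def by (auto simp: mem)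
  then have "prob D = (\<Sum>j\<in>I. prob (D' j))"
    unfolding D_eq using fin D'(1) by (intro finite_measure_finite_Union) auto
  also have "\<dots> = (\<Sum>G\<in>Pow (pairs V). \<Sum>H\<in>copies \<Gamma> V G. prob (D' (G, H)))"
    unfolding I_def using finite_pairs[OF V(1)]
    by (subst sum.Sigma) (auto simp: split_beta intro: finite_copies[OF V(1)])
  also have "\<dots> = (\<Sum>G\<in>Pow (pairs V). \<Sum>H\<in>copies \<Gamma> V G.
      p n ^ card (edges \<Gamma>) * (1 - p n) ^ (card G - card (edges \<Gamma>)) * config_integral f A V G r)"
  proof (intro sum.cong refl)
    fix G H assume "G \<in> Pow (pairs V)" "H \<in> copies \<Gamma> V G"
    then show "prob (D' (G, H)) = p n ^ card (edges \<Gamma>) * (1 - p n) ^ (card G - card (edges \<Gamma>)) * config_integral f A V G r"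
      using D'(2)[of G H] card_copy[OF V(1) _ \<Gamma>, of G H] by (simp add: I_def)
  qed
  also have "\<dots> = p n ^ card (edges \<Gamma>) * (\<Sum>G\<in>Pow (pairs V). real (card (copies \<Gamma> V G)) *
      (1 - p n) ^ (card G - card (edges \<Gamma>)) * config_integral f A V G r)"
    by (simp add: sum_distrib_left mult_ac)
  finally show "prob D = p n ^ card (edges \<Gamma>) * (\<Sum>G\<in>Pow (pairs V). real (card (copies \<Gamma> V G)) *
      (1 - p n) ^ (card G - card (edges \<Gamma>)) * config_integral f A V G r)" .
qed

text \<open>By exchangeability every \<open>k\<close>-element index set contributes the same probability.\<close>

lemma expectation_induced_count:
  fixes f :: "real ^ 'd::{finite, linorder} \<Rightarrow> real" and V :: "'i set"
  assumes "percolated_points M f X p keep"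
    and n: "n \<ge> 1" and V: "finite V" "V \<noteq> {}" "card V = card (verts \<Gamma>)"
    and \<Gamma>: "simple_graph \<Gamma>" and A: "A \<in> sets borel"
  shows "prob_space.expectation M (\<lambda>\<omega>. real (induced_count \<Gamma> A (perc_graph X keep r n \<omega>))) =
    real (n choose card V) * (p n ^ card (edges \<Gamma>) * (\<Sum>G\<in>Pow (pairs V). real (card (copies \<Gamma> V G)) *
      (1 - p n) ^ (card G - card (edges \<Gamma>)) * config_integral f A V G (r n)))"
proof -
  interpret percolated_points M f X p keep by fact
  define \<J> where "\<J> = {J. J \<subseteq> {1..n} \<and> card J = card V}"
  have fin\<J>: "finite \<J>" unfolding \<J>_def by (rule finite_subset[of _ "Pow {1..n}"]) auto
  have "\<exists>b. bij_betw b V J" if "J \<in> \<J>" for J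
    using that V(1) by (intro finite_same_card_bij) (auto simp: \<J>_def intro: finite_subset)
  then obtain b where b: "\<And>J. J \<in> \<J> \<Longrightarrow> bij_betw (b J) V J" by metis
  define D where "D J = {\<omega> \<in> space M. leftmost_in A ((\<lambda>i. X (b J i) \<omega>) ` V) \<and>
      graph_iso (V, kept_edges V (\<lambda>i. X (b J i) \<omega>) (r n) (\<lambda>e. keep n (b J ` e) \<omega>)) \<Gamma>}" for J
  define Q where "Q = p n ^ card (edges \<Gamma>) * (\<Sum>G\<in>Pow (pairs V). real (card (copies \<Gamma> V G)) *
      (1 - p n) ^ (card G - card (edges \<Gamma>)) * config_integral f A V G (r n))"
  have D: "D J \<in> events" "prob (D J) = Q" if "J \<in> \<J>" for J
  proof -
    have bJ: "inj_on (b J) V" "b J ` V \<subseteq> {1..n}"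
      using b[OF that] that by (auto simp: bij_betw_def \<J>_def)
    show "D J \<in> events" "prob (D J) = Q"
      using prob_labelled_copy[OF assms(1) n V(1,2) bJ \<Gamma> A, of "r n"] by (simp_all add: D_def Q_def)
  qed
  have count: "real (induced_count \<Gamma> A (perc_graph X keep r n \<omega>)) = (\<Sum>J\<in>\<J>. indicator (D J) \<omega>)"
    if inj: "inj_on (\<lambda>i. X i \<omega>) {1..n}" and \<omega>: "\<omega> \<in> space M" for \<omega>
  proof -
    let ?K = "({1..n}, kept_edges {1..n} (\<lambda>i. X i \<omega>) (r n) (\<lambda>e. keep n e \<omega>))"
    have "{J. J \<subseteq> {1..n} \<and> graph_iso (induced ?K J) \<Gamma> \<and> leftmost_in A ((\<lambda>i. X i \<omega>) ` J)} =
        {J \<in> \<J>. \<omega> \<in> D J}" (is "?L = ?R")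
    proof (intro set_eqI)
      fix J
      show "J \<in> ?L \<longleftrightarrow> J \<in> ?R"
      proof (cases "J \<in> \<J>")
        case True
        then have J: "J \<subseteq> {1..n}" by (simp add: \<J>_def)
        have "(\<lambda>i. X i \<omega>) ` (b J ` V) = (\<lambda>i. X i \<omega>) ` J"
          by (simp only: bij_betw_imp_surj_on[OF b[OF True]])
        then have "(\<lambda>i. X (b J i) \<omega>) ` V = (\<lambda>i. X i \<omega>) ` J"
          by (simp only: image_image)
        then show ?thesis
          using induced_kept_edges_iso[OF b[OF True] J, of "\<lambda>i. X i \<omega>" "r n" "\<lambda>e. keep n e \<omega>" \<Gamma>] True J \<omega>
          by (simp add: D_def comp_def conj_commute)
      next
        case False
        have "card J = card V" if "graph_iso (induced ?K J) \<Gamma>"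
          using graph_iso_card_verts[OF that] V(3) by (simp add: induced_def)
        with False show ?thesis by (auto simp: \<J>_def)
      qed
    qed
    then have "induced_count \<Gamma> A (perc_graph X keep r n \<omega>) = card {J \<in> \<J>. \<omega> \<in> D J}"
      using induced_count_perc_graph[of X \<omega> n \<Gamma> A keep r, OF inj] by (simp only:)
    also have "real \<dots> = (\<Sum>J\<in>\<J>. indicator (D J) \<omega>)"
      using fin\<J> by (simp add: indicator_def sum.If_cases Int_def of_bool_def)
    finally show ?thesis .
  qed
  have "(\<lambda>\<omega>. induced_count \<Gamma> A (perc_graph X keep r n \<omega>)) \<in> measurable M (count_space UNIV)"
    by (rule measurable_induced_count) (use n A in \<open>auto intro!: measurable_point marks_measurable\<close>)
  then have meas: "(\<lambda>\<omega>. real (induced_count \<Gamma> A (perc_graph X keep r n \<omega>))) \<in> borel_measurable M"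
    by (rule measurable_compose) simp
  have "expectation (\<lambda>\<omega>. real (induced_count \<Gamma> A (perc_graph X keep r n \<omega>))) =
      expectation (\<lambda>\<omega>. \<Sum>J\<in>\<J>. indicator (D J) \<omega>)"
  proof (rule integral_cong_AE[OF meas])
    show "(\<lambda>\<omega>. \<Sum>J\<in>\<J>. indicator (D J) \<omega> :: real) \<in> borel_measurable M"
      using D(1) by (intro borel_measurable_sum borel_measurable_indicator) auto
    show "AE \<omega> in M. real (induced_count \<Gamma> A (perc_graph X keep r n \<omega>)) = (\<Sum>J\<in>\<J>. indicator (D J) \<omega>)"
      using AE_points_distinct[of n] AE_space by eventually_elim (rule count)
  qed
  also have "\<dots> = (\<Sum>J\<in>\<J>. expectation (indicator (D J)))"
    using D(1) by (intro Bochner_Integration.integral_sum) (auto simp: emeasure_eq_measure)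
  also have "\<dots> = (\<Sum>J\<in>\<J>. Q)"
    using D by (intro sum.cong refl) (simp add: sets.sets_into_space Int_absorb2)
  also have "\<dots> = real (card \<J>) * Q" by simp
  also have "card \<J> = n choose card V"
    unfolding \<J>_def using n_subsets[of "{1..n}" "card V"] by simp
  finally show ?thesis unfolding Q_def .
qed

section \<open>Graphs on the limiting configuration\<close>

lemma geom_graph_image_iso:
  assumes "inj_on x V"
  shows "graph_iso (V, proximity_edges V x r) (geom_graph (x ` V) r)"
proof -
  have "verts (geom_graph (x ` V) r) = x ` V" by (simp add: geom_graph_def)
  then show ?thesis
    unfolding graph_iso_def using assms inj_on_eq_iff[OF assms]
    by (intro exI[of _ x]) (auto simp: bij_betw_def doubleton_in_geom_graph doubleton_in_proximity_edges)
qed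

text \<open>A subgraph isomorphic to \<open>\<Gamma>\<close> has as many vertices as \<open>\<Gamma>\<close> and hence spans the configuration; its edges can be
  pulled back along \<open>x\<close>.\<close>

lemma copies_of_subgraph:
  assumes x: "inj_on x V" and V: "finite V" "card V = card (verts \<Gamma>)"
    and H: "subgraph H (geom_graph (x ` V) r)" "graph_iso H \<Gamma>"
  shows "copies \<Gamma> V (proximity_edges V x r) \<noteq> {}"
proof -
  have "card (verts H) = card (x ` V)"
    using graph_iso_card_verts[OF H(2)] V(2) by (simp add: card_image[OF x])
  moreover have "verts H \<subseteq> x ` V" using H(1) by (simp add: subgraph_def geom_graph_def)
  ultimately have vH: "verts H = x ` V" using V(1) by (intro card_subset_eq) auto
  define K where "K = {e \<in> proximity_edges V x r. x ` e \<in> edges H}"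
  have "{u, v} \<in> K \<longleftrightarrow> {x u, x v} \<in> edges H" if uv: "u \<in> V" "v \<in> V" for u v
  proof -
    have "{u, v} \<in> proximity_edges V x r" if "{x u, x v} \<in> edges H"
    proof -
      have "{x u, x v} \<in> edges (geom_graph (x ` V) r)" using that H(1) by (auto simp: subgraph_def)
      then show ?thesis
        using uv unfolding doubleton_in_geom_graph doubleton_in_proximity_edges by blast
    qed
    then show ?thesis by (auto simp: K_def)
  qed
  then have "graph_iso (V, K) H"
    unfolding graph_iso_def using x vH by (intro exI[of _ x]) (auto simp: bij_betw_def)
  then have "K \<in> copies \<Gamma> V (proximity_edges V x r)"
    using graph_iso_trans[OF _ H(2)] by (auto simp: copies_def K_def)
  then show ?thesis by blast
qed

text \<open>A connected spanning subgraph makes the graph connected.\<close>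

lemma copy_connected:
  assumes \<Gamma>: "simple_graph \<Gamma>" "connected_graph \<Gamma>" and "copies \<Gamma> V G \<noteq> {}"
    and "i \<in> V" "j \<in> V"
  shows "(i, j) \<in> {(u, v). {u, v} \<in> G}\<^sup>*"
proof -
  obtain H where H: "H \<subseteq> G" "graph_iso (V, H) \<Gamma>" using assms(3) by (auto simp: copies_def)
  obtain \<psi> where \<psi>: "bij_betw \<psi> (verts \<Gamma>) V"
      "\<And>u v. u \<in> verts \<Gamma> \<Longrightarrow> v \<in> verts \<Gamma> \<Longrightarrow> {u, v} \<in> edges \<Gamma> \<longleftrightarrow> {\<psi> u, \<psi> v} \<in> H"
    using graph_iso_sym[OF H(2)] unfolding graph_iso_def by auto
  have "i \<in> \<psi> ` verts \<Gamma>" "j \<in> \<psi> ` verts \<Gamma>"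
    unfolding bij_betw_imp_surj_on[OF \<psi>(1)] using assms(4,5) by auto
  then obtain a c where ac: "a \<in> verts \<Gamma>" "c \<in> verts \<Gamma>" "i = \<psi> a" "j = \<psi> c" by blast
  have "(a, c) \<in> {(x, y). {x, y} \<in> edges \<Gamma>}\<^sup>*"
    using \<Gamma>(2) ac by (simp add: connected_graph_def)
  then have "(\<psi> a, \<psi> c) \<in> {(u, v). {u, v} \<in> G}\<^sup>*"
  proof (induction rule: rtrancl_induct)
    case (step y z)
    then have yz: "{y, z} \<in> edges \<Gamma>" by simp
    then have "y \<in> verts \<Gamma>" "z \<in> verts \<Gamma>" using \<Gamma>(1) by (auto simp: simple_graph_def)
    then have "{\<psi> y, \<psi> z} \<in> G" using \<psi>(2) yz H(1) by blast
    with step.IH show ?case by (auto intro: rtrancl_into_rtrancl)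
  qed simp
  then show ?thesis using ac by simp
qed

text \<open>The type argument fixes the dimension of the ambient space, which does not occur in the other
  arguments.\<close>

definition config_volume :: "'d::finite itself \<Rightarrow> 'i \<Rightarrow> 'i set \<Rightarrow> 'i set set \<Rightarrow> real" where
  "config_volume _ z I G = measure (PiM I (\<lambda>_. lborel :: (real ^ 'd) measure)) (config_set z I G)"

text \<open>This bounds the inner integrals of \<open>\<mu>\<close> and \<open>\<mu>'\<close>, whose integrands are values of \<open>u\<close>. A bound
  from above is all that is wanted, and it holds even for a non-integrable \<open>u\<close>, whose integral is \<open>0\<close> by
  convention; so it is enough to dominate \<open>u\<close> pointwise by an integrable sum of indicators.\<close>

lemma integral_le_config_volumes:
  fixes u :: "(nat \<Rightarrow> real ^ 'd) \<Rightarrow> real"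
  assumes I: "finite I" "z \<notin> I" and \<Gamma>: "simple_graph \<Gamma>" "connected_graph \<Gamma>"
    and P: "\<And>G. P G \<Longrightarrow> copies \<Gamma> (insert z I) G \<noteq> {}"
    and u: "\<And>y. y \<in> space (PiM I (\<lambda>_. lborel)) \<Longrightarrow> u y = 0 \<or>
      u y = 1 \<and> P (proximity_edges (insert z I) (y(z := 0)) 1)"
  shows "(\<integral>y. u y \<partial>PiM I (\<lambda>_. lborel)) \<le>
    (\<Sum>G\<in>{G \<in> Pow (pairs (insert z I)). P G}. config_volume TYPE('d) z I G)"
proof -
  let ?L = "PiM I (\<lambda>_. lborel :: (real ^ 'd) measure)"
  let ?G = "{G \<in> Pow (pairs (insert z I)). P G}"
  have fin: "finite ?G" using finite_pairs[of "insert z I"] I(1) by simp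
  have int: "integrable ?L (indicator (config_set z I G) :: _ \<Rightarrow> real)" if "G \<in> ?G" for G
    using emeasure_config_set_finite[OF I, of G, where 'a = "real ^ 'd"] that
      copy_connected[OF \<Gamma> P, of G z] config_set_sets[OF I(1), of z G, where 'a = "real ^ 'd"]
    by simp
  have "(\<integral>y. u y \<partial>?L) \<le> (\<integral>y. (\<Sum>G\<in>?G. indicator (config_set z I G) y) \<partial>?L)"
  proof (rule integral_mono')
    show "integrable ?L (\<lambda>y. \<Sum>G\<in>?G. indicator (config_set z I G) y :: real)"
      using int by (intro Bochner_Integration.integrable_sum) auto
    fix y assume y: "y \<in> space ?L"
    show "u y \<le> (\<Sum>G\<in>?G. indicator (config_set z I G) y)"
    proof (cases "u y = 0")
      case True
      then show ?thesis by (simp add: sum_nonneg)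
    next
      case False
      let ?E = "proximity_edges (insert z I) (y(z := 0)) 1"
      have "?E \<in> ?G" using u[OF y] False proximity_edges_subset_pairs[of "insert z I"] by auto
      moreover have "y \<in> config_set z I ?E" using y by (simp add: config_set_def)
      ultimately have "1 \<le> (\<Sum>G\<in>?G. indicator (config_set z I G) y :: real)"
        using fin member_le_sum[of ?E ?G "\<lambda>G. indicator (config_set z I G) y :: real"] by simp
      then show ?thesis using u[OF y] False by simp
    qed
  qed (simp add: sum_nonneg)
  also have "\<dots> = (\<Sum>G\<in>?G. config_volume TYPE('d) z I G)"
    using int unfolding config_volume_def
    by (subst Bochner_Integration.integral_sum) (auto simp: config_set_def intro!: sum.cong arg_cong[where f = "measure ?L"])
  finally show ?thesis .
qed

section \<open>The limit of the expected count\<close>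

lemma binomial_over_power_tendsto: "(\<lambda>n. real (n choose k) / real n ^ k) \<longlonglongrightarrow> 1 / fact k"
proof -
  have "(\<lambda>n. (real n - real i) / real n) \<longlonglongrightarrow> 1" for i
    by real_asymp
  then have "(\<lambda>n. (\<Prod>i=0..<k. (real n - real i) / real n) / fact k) \<longlonglongrightarrow> (\<Prod>i=0..<k. 1) / fact k"
    by (intro tendsto_intros) auto
  moreover have "(\<Prod>i=0..<k. (real n - real i) / real n) / fact k = real (n choose k) / real n ^ k" for n
    by (simp add: binomial_gbinomial gbinomial_prod_rev prod_dividef)
  ultimately show ?thesis by simp
qed

text \<open>The limit of the normalised expectation when \<open>p\<^sub>n\<close> tends to \<open>q\<close>.\<close>

definition count_limit ::
  "'v sgraph \<Rightarrow> (real ^ 'd::{finite, linorder} \<Rightarrow> real) \<Rightarrow> (real ^ 'd::{finite, linorder}) set \<Rightarrow> real \<Rightarrow> real" where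
  "count_limit \<Gamma> f A q = (let k = card (verts \<Gamma>); I = {1..k-1} in
     1 / fact k * (\<Sum>G\<in>Pow (pairs (insert 0 I)). real (card (copies \<Gamma> (insert 0 I) G)) *
       (1 - q) ^ (card G - card (edges \<Gamma>)) *
       ((LINT x:A|lborel. f x ^ k) * config_volume TYPE('d) 0 I G)))"

lemma normalised_expectation_tendsto:
  fixes f :: "real ^ 'd::{finite, linorder} \<Rightarrow> real" and \<Gamma> :: "'v sgraph"
  assumes points: "percolated_points M f X p keep"
    and r: "\<And>n. n \<ge> 1 \<Longrightarrow> 0 < r n" "r \<longlonglongrightarrow> 0"
    and \<Gamma>: "simple_graph \<Gamma>" "connected_graph \<Gamma>" "card (verts \<Gamma>) = k" "k \<ge> 2" "card (edges \<Gamma>) = m"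
    and A: "open A" "frontier A \<in> null_sets lborel"
    and E: "\<And>n. E n = prob_space.expectation M (\<lambda>\<omega>. real (induced_count \<Gamma> A (perc_graph X keep r n \<omega>)))"
    and q: "p \<longlonglongrightarrow> q"
  shows "(\<lambda>n. p n powi (- int m) * real n powi (- int k) *
    r n powi (- int (CARD('d) * (k - 1))) * E n) \<longlonglongrightarrow> count_limit \<Gamma> f A q"
proof -
  interpret percolated_points M f X p keep by fact
  define I where "I = {1..k-1}"
  define V where "V = insert 0 I"
  have I: "finite I" "0 \<notin> I" "card I = k - 1" by (auto simp: I_def)
  have V: "finite V" "V \<noteq> {}" "card V = k" using I \<Gamma>(4) by (auto simp: V_def)
  have Am: "A \<in> sets borel" using A(1) by simp
  obtain B where "\<And>x. \<bar>f x\<bar> \<le> B"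
    using density_bounded by (auto simp: bounded_iff)
  then have B: "f x \<le> B" for x by (meson abs_le_D1)
  define c where "c G = real (card (copies \<Gamma> V G))" for G
  define F where "F G n = config_integral f A V G (r n) / r n ^ (CARD('d) * (k - 1))" for G n
  define J0 where "J0 = (LINT x:A|lborel. f x ^ k)"
  have J0: "(\<integral>a. f a ^ Suc (card I) * indicator A a \<partial>lborel) = J0"
    using I(3) \<Gamma>(4) by (simp add: J0_def set_lebesgue_integral_def mult.commute)
  have limF: "(\<lambda>n. c G * (1 - p n) ^ (card G - m) * F G n) \<longlonglongrightarrow>
      c G * (1 - q) ^ (card G - m) * (J0 * config_volume TYPE('d) 0 I G)" for G
  proof (cases "copies \<Gamma> V G = {}")
    case True
    then show ?thesis by (simp add: c_def)
  next
    case False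
    have conn: "(0, i) \<in> {(u, v). {u, v} \<in> G}\<^sup>*" if "i \<in> I" for i
      by (rule copy_connected[OF \<Gamma>(1,2) False]) (use that in \<open>auto simp: V_def\<close>)
    have "(\<lambda>n. F G n) \<longlonglongrightarrow> J0 * config_volume TYPE('d) 0 I G"
      unfolding F_def V_def config_volume_def J0[symmetric] I(3)[symmetric]
      by (rule config_integral_tendsto[OF integrable_density density_nonneg B A r(2,1) I(1,2) conn])
    then show ?thesis by (intro tendsto_intros q)
  qed
  have "(\<lambda>n. real (n choose k) / real n ^ k * (\<Sum>G\<in>Pow (pairs V). c G * (1 - p n) ^ (card G - m) * F G n)) \<longlonglongrightarrow>
      1 / fact k * (\<Sum>G\<in>Pow (pairs V). c G * (1 - q) ^ (card G - m) * (J0 * config_volume TYPE('d) 0 I G))"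
    by (intro tendsto_mult binomial_over_power_tendsto tendsto_sum limF)
  moreover have "eventually (\<lambda>n. real (n choose k) / real n ^ k *
      (\<Sum>G\<in>Pow (pairs V). c G * (1 - p n) ^ (card G - m) * F G n) =
      p n powi (- int m) * real n powi (- int k) * r n powi (- int (CARD('d) * (k - 1))) * E n) sequentially"
    using eventually_ge_at_top[of 1]
  proof eventually_elim
    case (elim n)
    define s where "s = r n ^ (CARD('d) * (k - 1))"
    have s: "s \<noteq> 0" using r(1)[OF elim] by (simp add: s_def)
    have pn: "p n \<noteq> 0" using prob_range[OF elim] by simp
    have En: "E n = real (n choose k) * (p n ^ m * (\<Sum>G\<in>Pow (pairs V). c G * (1 - p n) ^ (card G - m) * config_integral f A V G (r n)))"
      unfolding E c_def
      using expectation_induced_count[OF points elim V(1,2) _ \<Gamma>(1) Am, of r] V(3) \<Gamma>(3,5) by simp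
    have sum: "(\<Sum>G\<in>Pow (pairs V). c G * (1 - p n) ^ (card G - m) * F G n) =
        (\<Sum>G\<in>Pow (pairs V). c G * (1 - p n) ^ (card G - m) * config_integral f A V G (r n)) / s"
      by (simp add: F_def s_def sum_divide_distrib)
    show ?case
      unfolding En sum power_int_minus power_int_of_nat s_def[symmetric]
      using s pn elim by (simp add: field_simps)
  qed
  ultimately have "(\<lambda>n. p n powi (- int m) * real n powi (- int k) *
      r n powi (- int (CARD('d) * (k - 1))) * E n) \<longlonglongrightarrow>
      1 / fact k * (\<Sum>G\<in>Pow (pairs V). c G * (1 - q) ^ (card G - m) * (J0 * config_volume TYPE('d) 0 I G))"
    by (rule Lim_transform_eventually)
  then show ?thesis
    unfolding count_limit_def Let_def \<Gamma>(3,5) I_def[symmetric] V_def[symmetric] c_def J0_def .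
qed

text \<open>The bound is taken graph by graph. A graph isomorphic to \<open>\<Gamma>\<close> has \<open>m\<close> edges and contains itself as
  a copy, so its coefficient is at least \<open>1\<close>. A graph that strictly contains \<open>\<Gamma>\<close> has at least one
  copy, and at most \<open>k choose 2\<close> edges, so its coefficient is at least \<open>\<theta>\<close>.\<close>

lemma count_limit_ge:
  fixes f :: "real ^ 'd::{finite, linorder} \<Rightarrow> real" and \<Gamma> :: "'v sgraph"
  assumes \<Gamma>: "simple_graph \<Gamma>" "connected_graph \<Gamma>" "card (verts \<Gamma>) = k" "k \<ge> 2"
    and f: "\<And>x. 0 \<le> f x" and q: "q \<le> 1" and \<theta>: "0 \<le> \<theta>" "\<And>j. j \<le> k choose 2 \<Longrightarrow> \<theta> \<le> (1 - q) ^ j"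
  shows "count_limit \<Gamma> f A q \<ge> mu \<Gamma> f A + \<theta> * mu' \<Gamma> f A"
proof -
  define I where "I = {1..k-1}"
  define V where "V = insert 0 I"
  have I: "finite I" "0 \<notin> I" "card I = k - 1" by (auto simp: I_def)
  have V: "finite V" "card V = card (verts \<Gamma>)" using I \<Gamma>(3,4) by (auto simp: V_def)
  let ?L = "PiM I (\<lambda>_. lborel :: (real ^ 'd::{finite, linorder}) measure)"
  let ?iso = "\<lambda>G. graph_iso (V, G) \<Gamma>"
  let ?strict = "\<lambda>G. copies \<Gamma> V G \<noteq> {} \<and> \<not> graph_iso (V, G) \<Gamma>"
  let ?vol = "\<lambda>G. config_volume TYPE('d) 0 I G"
  have vol: "0 \<le> ?vol G" for G by (simp add: config_volume_def)
  define J0 where "J0 = (LINT x:A|lborel. f x ^ k)"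
  have J0: "0 \<le> J0"
    unfolding J0_def set_lebesgue_integral_def by (intro Bochner_Integration.integral_nonneg) (simp add: f)
  have self: "copies \<Gamma> V G \<noteq> {}" if "?iso G" for G using that by (auto simp: copies_def)
  have image: "insert 0 (y ` I) = (y(0 := 0)) ` V" for y :: "nat \<Rightarrow> real ^ 'd::{finite, linorder}"
  proof -
    have "(y(0 := 0)) ` I = y ` I" using I(2) by (intro image_cong) auto
    then show ?thesis by (simp only: V_def image_insert fun_upd_same)
  qed
  have inj: "inj_on (y(0 := 0)) V" if "card (insert 0 (y ` I)) = card (verts \<Gamma>)"
    for y :: "nat \<Rightarrow> real ^ 'd::{finite, linorder}"
    using that V unfolding image by (intro eq_card_imp_inj_on) auto
  have h: "(\<integral>y. h_fun \<Gamma> (insert 0 (y ` I)) \<partial>?L) \<le> (\<Sum>G\<in>{G \<in> Pow (pairs V). ?iso G}. ?vol G)"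
    unfolding V_def
  proof (rule integral_le_config_volumes[OF I(1,2) \<Gamma>(1,2)])
    show "copies \<Gamma> (insert 0 I) G \<noteq> {}" if "graph_iso (insert 0 I, G) \<Gamma>" for G
      using self[of G] that by (simp add: V_def)
    fix y :: "nat \<Rightarrow> real ^ 'd::{finite, linorder}"
    have "?iso (proximity_edges V (y(0 := 0)) 1)" if "h_fun \<Gamma> (insert 0 (y ` I)) \<noteq> 0"
    proof -
      from that have "card (insert 0 (y ` I)) = card (verts \<Gamma>)" "graph_iso (geom_graph (insert 0 (y ` I)) 1) \<Gamma>"
        by (auto simp: h_fun_def split: if_splits)
      then show ?thesis
        using graph_iso_trans[OF geom_graph_image_iso[OF inj], of y 1 \<Gamma>] unfolding image by blast
    qed
    then show "h_fun \<Gamma> (insert 0 (y ` I)) = 0 \<or> h_fun \<Gamma> (insert 0 (y ` I)) = 1 \<and>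
        graph_iso (insert 0 I, proximity_edges (insert 0 I) (y(0 := 0)) 1) \<Gamma>"
      unfolding V_def by (auto simp: h_fun_def)
  qed
  have g: "(\<integral>y. g_fun \<Gamma> (insert 0 (y ` I)) \<partial>?L) \<le> (\<Sum>G\<in>{G \<in> Pow (pairs V). ?strict G}. ?vol G)"
    unfolding V_def
  proof (rule integral_le_config_volumes[OF I(1,2) \<Gamma>(1,2)])
    fix y :: "nat \<Rightarrow> real ^ 'd::{finite, linorder}"
    have "?strict (proximity_edges V (y(0 := 0)) 1)" if "g_fun \<Gamma> (insert 0 (y ` I)) \<noteq> 0"
    proof -
      from that have y: "card (insert 0 (y ` I)) = card (verts \<Gamma>)"
          "strictly_contains (geom_graph (insert 0 (y ` I)) 1) \<Gamma>"
        by (auto simp: g_fun_def split: if_splits)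
      note x = inj[OF y(1)]
      obtain H where "subgraph H (geom_graph ((y(0 := 0)) ` V) 1)" "graph_iso H \<Gamma>"
          "\<not> graph_iso (geom_graph ((y(0 := 0)) ` V) 1) \<Gamma>"
        using y(2) unfolding strictly_contains_def image by blast
      then show ?thesis
        using copies_of_subgraph[OF x V] graph_iso_cong[OF geom_graph_image_iso[OF x], of 1 \<Gamma>] by blast
    qed
    then show "g_fun \<Gamma> (insert 0 (y ` I)) = 0 \<or> g_fun \<Gamma> (insert 0 (y ` I)) = 1 \<and>
        copies \<Gamma> (insert 0 I) (proximity_edges (insert 0 I) (y(0 := 0)) 1) \<noteq> {} \<and>
        \<not> graph_iso (insert 0 I, proximity_edges (insert 0 I) (y(0 := 0)) 1) \<Gamma>"
      unfolding V_def by (auto simp: g_fun_def)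
  qed auto
  have finP: "finite (Pow (pairs V))" using finite_pairs[OF V(1)] by simp
  have weight: "of_bool (?iso G) + \<theta> * of_bool (?strict G) \<le>
      real (card (copies \<Gamma> V G)) * (1 - q) ^ (card G - card (edges \<Gamma>))" if G: "G \<in> Pow (pairs V)" for G
  proof (cases "copies \<Gamma> V G = {}")
    case True
    then show ?thesis using self[of G] by auto
  next
    case False
    have "finite (copies \<Gamma> V G)" using finite_copies[OF V(1), of G \<Gamma>] G by simp
    with False have "card (copies \<Gamma> V G) \<ge> 1" by (simp add: Suc_leI card_gt_0_iff)
    then have "1 \<le> real (card (copies \<Gamma> V G))" by simp
    then have c: "(1 - q) ^ (card G - card (edges \<Gamma>)) \<le> real (card (copies \<Gamma> V G)) * (1 - q) ^ (card G - card (edges \<Gamma>))"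
      using mult_right_mono[of 1 "real (card (copies \<Gamma> V G))" "(1 - q) ^ (card G - card (edges \<Gamma>))"] q by simp
    show ?thesis
    proof (cases "?iso G")
      case True
      then have "card G = card (edges \<Gamma>)"
        using card_copy[OF V(1) _ \<Gamma>(1), of G G] G by (simp add: copies_def)
      with c True show ?thesis by simp
    next
      case notiso: False
      have "card G \<le> card (pairs V)" using G finite_pairs[OF V(1)] by (intro card_mono) auto
      also have "card (pairs V) = k choose 2" using card_pairs[OF V(1)] V(2) \<Gamma>(3) by simp
      finally have "\<theta> \<le> (1 - q) ^ (card G - card (edges \<Gamma>))" by (intro \<theta>(2)) simp
      with c notiso False show ?thesis by simp
    qed
  qed
  have "mu \<Gamma> f A = 1 / fact k * J0 * (\<integral>y. h_fun \<Gamma> (insert 0 (y ` I)) \<partial>?L)"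
    by (simp add: mu_def Let_def \<Gamma>(3) I_def J0_def)
  moreover have "mu' \<Gamma> f A = 1 / fact k * J0 * (\<integral>y. g_fun \<Gamma> (insert 0 (y ` I)) \<partial>?L)"
    by (simp add: mu'_def Let_def \<Gamma>(3) I_def J0_def)
  ultimately have "mu \<Gamma> f A + \<theta> * mu' \<Gamma> f A = 1 / fact k * J0 *
      ((\<integral>y. h_fun \<Gamma> (insert 0 (y ` I)) \<partial>?L) + \<theta> * (\<integral>y. g_fun \<Gamma> (insert 0 (y ` I)) \<partial>?L))"
    by (simp add: algebra_simps)
  also have "\<dots> \<le> 1 / fact k * J0 * ((\<Sum>G\<in>{G \<in> Pow (pairs V). ?iso G}. ?vol G) +
      \<theta> * (\<Sum>G\<in>{G \<in> Pow (pairs V). ?strict G}. ?vol G))"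
    using h g \<theta>(1) J0 by (intro mult_left_mono add_mono) auto
  also have "(\<Sum>G\<in>{G \<in> Pow (pairs V). ?iso G}. ?vol G) = (\<Sum>G\<in>Pow (pairs V). of_bool (?iso G) * ?vol G)"
    using finP by (intro sum.mono_neutral_cong_left) auto
  also have "(\<Sum>G\<in>{G \<in> Pow (pairs V). ?strict G}. ?vol G) = (\<Sum>G\<in>Pow (pairs V). of_bool (?strict G) * ?vol G)"
    using finP by (intro sum.mono_neutral_cong_left) auto
  also have "(\<Sum>G\<in>Pow (pairs V). of_bool (?iso G) * ?vol G) + \<theta> * (\<Sum>G\<in>Pow (pairs V). of_bool (?strict G) * ?vol G) =
      (\<Sum>G\<in>Pow (pairs V). (of_bool (?iso G) + \<theta> * of_bool (?strict G)) * ?vol G)"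
    by (simp only: sum_distrib_left sum.distrib[symmetric] distrib_right mult.assoc)
  also have "1 / fact k * J0 * \<dots> \<le> 1 / fact k * J0 *
      (\<Sum>G\<in>Pow (pairs V). real (card (copies \<Gamma> V G)) * (1 - q) ^ (card G - card (edges \<Gamma>)) * ?vol G)"
    using J0 by (intro mult_left_mono sum_mono mult_right_mono weight vol) auto
  also have "\<dots> = count_limit \<Gamma> f A q"
    unfolding count_limit_def Let_def \<Gamma>(3) I_def[symmetric] V_def[symmetric] J0_def
    by (simp add: sum_distrib_left mult_ac)
  finally show ?thesis .
qed

lemma tendsto_zero_of_square_times:
  assumes "(\<lambda>n. (real n)\<^sup>2 * p n) \<longlonglongrightarrow> a" shows "p \<longlonglongrightarrow> 0"
proof -
  have "(\<lambda>n. 1 / (real n)\<^sup>2) \<longlonglongrightarrow> 0" by real_asymp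
  from tendsto_mult[OF assms this] have "(\<lambda>n. (real n)\<^sup>2 * p n * (1 / (real n)\<^sup>2)) \<longlonglongrightarrow> 0" by simp
  moreover have "eventually (\<lambda>n. (real n)\<^sup>2 * p n * (1 / (real n)\<^sup>2) = p n) sequentially"
    using eventually_gt_at_top[of 0] by eventually_elim simp
  ultimately show ?thesis by (rule Lim_transform_eventually)
qed

theorem theorem2p3:
  fixes M :: "'w measure"
    and f :: "real ^ 'd :: {finite, linorder} \<Rightarrow> real"
    and X :: "nat \<Rightarrow> 'w \<Rightarrow> real ^ 'd :: {finite, linorder}"
    and p r :: "nat \<Rightarrow> real"
    and keep :: "nat \<Rightarrow> nat set \<Rightarrow> 'w \<Rightarrow> bool"
    and \<Gamma> :: "'v sgraph"
    and k m :: nat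
    and A :: "(real ^ 'd :: {finite, linorder}) set"
    and E :: "nat \<Rightarrow> real"
  assumes "percolated_points M f X p keep"
    and "\<And>n. n \<ge> 1 \<Longrightarrow> 0 < r n"
    and "simple_graph \<Gamma>" and "connected_graph \<Gamma>"
    and "card (verts \<Gamma>) = k" and "k \<ge> 2" and "card (edges \<Gamma>) = m"
    and "open A" and "frontier A \<in> null_sets lborel"
    and "r \<longlonglongrightarrow> 0"
    and E: "\<And>n. E n = prob_space.expectation M
              (\<lambda>\<omega>. real (induced_count \<Gamma> A (perc_graph X keep r n \<omega>)))"
  shows
    "(\<forall>p0. (\<forall>n\<ge>1. p n = p0) \<longrightarrow>
        (\<exists>L. (\<lambda>n. p0 powi (- int m) * real n powi (- int k) *
                   r n powi (- int (CARD('d :: {finite, linorder}) * (k - 1))) * E n) \<longlonglongrightarrow> L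
             \<and> L \<ge> mu \<Gamma> f A + (1 - p0) ^ (k choose 2) * mu' \<Gamma> f A)) \<and>
     (\<forall>\<alpha>>0. (\<lambda>n. (real n)\<^sup>2 * p n) \<longlonglongrightarrow> \<alpha> \<longrightarrow>
        (\<exists>L. (\<lambda>n. p n powi (- int m) * real n powi (- int k) *
                   r n powi (- int (CARD('d :: {finite, linorder}) * (k - 1))) * E n) \<longlonglongrightarrow> L
             \<and> L \<ge> mu \<Gamma> f A + exp (- \<alpha> / 2) * mu' \<Gamma> f A)) \<and>
     ((\<lambda>n. (real n)\<^sup>2 * p n) \<longlonglongrightarrow> 0 \<longrightarrow>
        (\<exists>L. (\<lambda>n. p n powi (- int m) * real n powi (- int k) *
                   r n powi (- int (CARD('d :: {finite, linorder}) * (k - 1))) * E n) \<longlonglongrightarrow> L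
             \<and> L \<ge> mu \<Gamma> f A + mu' \<Gamma> f A))"
proof -
  interpret percolated_points M f X p keep by fact
  have lim: "(\<lambda>n. p n powi (- int m) * real n powi (- int k) *
      r n powi (- int (CARD('d) * (k - 1))) * E n) \<longlonglongrightarrow> count_limit \<Gamma> f A q"
    if "p \<longlonglongrightarrow> q" for q
    by (rule normalised_expectation_tendsto[OF assms(1,2) \<open>r \<longlonglongrightarrow> 0\<close> assms(3,4,5,6,7,8,9) E that])
  have ge: "count_limit \<Gamma> f A q \<ge> mu \<Gamma> f A + \<theta> * mu' \<Gamma> f A"
    if "q \<le> 1" "0 \<le> \<theta>" "\<And>j. j \<le> k choose 2 \<Longrightarrow> \<theta> \<le> (1 - q) ^ j" for q \<theta>
    by (rule count_limit_ge[OF assms(3,4,5,6) density_nonneg that])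
  show ?thesis
  proof (intro conjI allI impI)
    fix p0 assume p0: "\<forall>n\<ge>1. p n = p0"
    then have range: "0 < p0" "p0 \<le> 1" using prob_range[of 1] by auto
    have ev: "eventually (\<lambda>n. p n = p0) sequentially"
      using eventually_ge_at_top[of 1] by eventually_elim (use p0 in auto)
    have "(\<lambda>n. p0 powi (- int m) * real n powi (- int k) *
        r n powi (- int (CARD('d) * (k - 1))) * E n) \<longlonglongrightarrow> count_limit \<Gamma> f A p0"
      by (rule Lim_transform_eventually[OF lim[OF tendsto_eventually[OF ev]]])
        (use ev in eventually_elim, simp)
    moreover have "count_limit \<Gamma> f A p0 \<ge> mu \<Gamma> f A + (1 - p0) ^ (k choose 2) * mu' \<Gamma> f A"
      by (rule ge) (use range in \<open>auto intro: power_decreasing\<close>)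
    ultimately show "\<exists>L. (\<lambda>n. p0 powi (- int m) * real n powi (- int k) *
        r n powi (- int (CARD('d) * (k - 1))) * E n) \<longlonglongrightarrow> L \<and>
        L \<ge> mu \<Gamma> f A + (1 - p0) ^ (k choose 2) * mu' \<Gamma> f A" by blast
  next
    fix \<alpha> :: real assume "\<alpha> > 0" "(\<lambda>n. (real n)\<^sup>2 * p n) \<longlonglongrightarrow> \<alpha>"
    from lim[OF tendsto_zero_of_square_times[OF this(2)]] ge[of 0 "exp (- \<alpha> / 2)"] \<open>\<alpha> > 0\<close>
    show "\<exists>L. (\<lambda>n. p n powi (- int m) * real n powi (- int k) *
        r n powi (- int (CARD('d) * (k - 1))) * E n) \<longlonglongrightarrow> L \<and>
        L \<ge> mu \<Gamma> f A + exp (- \<alpha> / 2) * mu' \<Gamma> f A" by auto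
  next
    assume "(\<lambda>n. (real n)\<^sup>2 * p n) \<longlonglongrightarrow> 0"
    from lim[OF tendsto_zero_of_square_times[OF this]] ge[of 0 1]
    show "\<exists>L. (\<lambda>n. p n powi (- int m) * real n powi (- int k) *
        r n powi (- int (CARD('d) * (k - 1))) * E n) \<longlonglongrightarrow> L \<and>
        L \<ge> mu \<Gamma> f A + mu' \<Gamma> f A" by auto
  qed
qed

end
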